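(* Let $a<b$ be real numbers, let $k\ge1$ be an integer, and let $f:[a,b]\to\mathbb{R}$ be a function such that $f^{(k)}$ is of bounded variation on $[a,b]$, with total variation $V_k=\mathrm{Var}(f^{(k)})<\infty$. Let $d$ and $n$ be integers such that $n\ge k$ and $k\le d\le 2n-k-1$, and let $\mathsf{C}_{d,n}[f]$ be the truncated Chebyshev series of $f$ with approximated coefficients. Then $$\|f-\mathsf{C}_{d,n}[f]\|_1\le\mathbb{T}_{d,n},$$ where: (1) if $d=n-l$ for some $l=1,2,\ldots,n-k$, then $$\mathbb{T}_{d,n}=\frac{4V_k(b-a)^{k+1}}{4^k k\pi}\sum_{j=0}^{k}\binom{k}{j}\frac{1}{(n-l+j)(n-l+j-1)\cdots(n-l+j-k+1)};$$ (2) if $d=n+l$ for some $l=0,1,2,\ldots,n-k-1$, then $$\mathbb{T}_{d,n}=\frac{6V_k(b-a)^{k+1}}{4^k k\pi}\sum_{j=0}^{k}\binom{k}{j}\frac{1}{(n-l+j-1)(n-l+j-2)\cdots(n-l+j-k)}.$$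
   Context: The map $\mathsf{G}:[-1,1]\to[a,b]$ is the bijection $\mathsf{G}(t)=a+\frac{b-a}{2}(t+1)$, and $T_j(t)=\cos(j\cos^{-1}t)$ is the Chebyshev polynomial of the first kind of degree $j$. The norm is $\|g\|_1=\int_a^b|g(x)|\,dx$. For integers $n\ge1$ and $j\ge 0$, the approximated Chebyshev coefficients of $f:[a,b]\to\mathbb{R}$ with $n$ quadrature points are $$c_{j,n}=\frac{2}{n}\sum_{l=1}^{n}f(\mathsf{G}(t_l))T_j(t_l),\qquad t_l=\cos\left(\frac{(2l-1)\pi}{2n}\right),\quad l=1,\ldots,n.$$ The truncated Chebyshev series of $f$ with approximated coefficients is $$\mathsf{C}_{d,n}[f](x)=\frac{c_{0,n}}{2}+\sum_{j=1}^{d}c_{j,n}T_j(\mathsf{G}^{-1}(x)),\qquad x\in[a,b].$$ Derivatives are understood in the weak (distributional) sense where classical derivatives fail to exist: $f,f',\ldots,f^{(k-1)}$ are absolutely continuous on $[a,b]$ and $f^{(k)}$ is a function of bounded variation on $[a,b]$ with $f^{(k-1)}(y)-f^{(k-1)}(x)=\int_x^y f^{(k)}(u)\,du$ for all $x,y\in[a,b]$. The products in the denominators of $\mathbb{T}_{d,n}$ each have $k$ factors (consecutive decreasing integers). *)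

theory Defs
  imports "HOL-Analysis.Analysis"
begin

text \<open>
  Functions on a real interval \<open>[a, b]\<close> are total functions \<open>real \<Rightarrow> real\<close> of which only the
  values on \<open>{a..b}\<close> are used.
\<close>

definition absolutely_continuous_on_interval :: "real \<Rightarrow> real \<Rightarrow> (real \<Rightarrow> real) \<Rightarrow> bool" where
  "absolutely_continuous_on_interval a b g \<longleftrightarrow>
     (\<forall>\<epsilon>>0. \<exists>\<delta>>0. \<forall>(m::nat) (u::nat \<Rightarrow> real) v.
        (\<forall>i<m. a \<le> u i \<and> u i \<le> v i \<and> v i \<le> b) \<longrightarrow>
        disjoint_family_on (\<lambda>i. {u i<..<v i}) {..<m} \<longrightarrow>
        (\<Sum>i<m. v i - u i) < \<delta> \<longrightarrow>
        (\<Sum>i<m. \<bar>g (v i) - g (u i)\<bar>) < \<epsilon>)"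

definition variation_sums :: "real \<Rightarrow> real \<Rightarrow> (real \<Rightarrow> real) \<Rightarrow> real set" where
  "variation_sums a b g =
     {\<Sum>i<m. \<bar>g (x (Suc i)) - g (x i)\<bar> | (m::nat) (x::nat \<Rightarrow> real).
        x 0 = a \<and> x m = b \<and> (\<forall>i<m. x i < x (Suc i))}"

definition bounded_variation :: "real \<Rightarrow> real \<Rightarrow> (real \<Rightarrow> real) \<Rightarrow> bool" where
  "bounded_variation a b g \<longleftrightarrow> bdd_above (variation_sums a b g)"

definition total_variation :: "real \<Rightarrow> real \<Rightarrow> (real \<Rightarrow> real) \<Rightarrow> real" where
  "total_variation a b g = Sup (variation_sums a b g)"

text \<open>
  \<open>D i\<close> plays the role of the \<open>i\<close>-th derivative of \<open>f\<close> on \<open>[a, b]\<close>, for \<open>i \<le> k\<close> and \<open>k \<ge> 1\<close>.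
  Below order \<open>k\<close> the derivatives are classical (one-sided at the end points). The last one,
  \<open>D k\<close>, is only a weak derivative, pinned down up to a null set by the integral identity; hence
  it is carried along as data. The integral is oriented, so \<open>y < x\<close> is allowed.
  Bounded variation of \<open>D k\<close> makes it integrable, so that the integral does not
  take its default value 0.
\<close>

definition bv_derivatives ::
    "real \<Rightarrow> real \<Rightarrow> nat \<Rightarrow> (real \<Rightarrow> real) \<Rightarrow> (nat \<Rightarrow> real \<Rightarrow> real) \<Rightarrow> bool" where
  "bv_derivatives a b k f D \<longleftrightarrow>
     (\<forall>x\<in>{a..b}. D 0 x = f x) \<and>
     (\<forall>i<k. absolutely_continuous_on_interval a b (D i)) \<and>
     (\<forall>i. Suc i < k \<longrightarrow>
        (\<forall>x\<in>{a..b}. (D i has_real_derivative D (Suc i) x) (at x within {a..b}))) \<and>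
     bounded_variation a b (D k) \<and>
     (\<forall>x\<in>{a..b}. \<forall>y\<in>{a..b}. D (k - 1) y - D (k - 1) x = (LBINT u=x..y. D k u))"

definition l1_norm :: "real \<Rightarrow> real \<Rightarrow> (real \<Rightarrow> real) \<Rightarrow> real" where
  "l1_norm a b g = (LBINT x=a..b. \<bar>g x\<bar>)"

definition cheb_map :: "real \<Rightarrow> real \<Rightarrow> real \<Rightarrow> real" where
  "cheb_map a b t = a + (b - a) / 2 * (t + 1)"

lemma cheb_map_bij_betw:
  assumes "a < b"
  shows "bij_betw (cheb_map a b) {-1..1} {a..b}"
proof (rule bij_betw_byWitness[where f' = "\<lambda>x. 2 * (x - a) / (b - a) - 1"])
  show "cheb_map a b ` {-1..1} \<subseteq> {a..b}"
  proof safe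
    fix t :: real assume t: "t \<in> {-1..1}"
    have "(b - a) / 2 * (t + 1) \<ge> 0" using assms t by simp
    moreover have "(b - a) / 2 * (t + 1) \<le> (b - a) / 2 * 2"
      using assms t by (intro mult_left_mono) auto
    ultimately show "cheb_map a b t \<in> {a..b}" by (simp add: cheb_map_def)
  qed
qed (use assms in \<open>auto simp: cheb_map_def field_simps\<close>)

lemma inv_into_cheb_map:
  assumes "a < b" "x \<in> {a..b}"
  shows "inv_into {-1..1} (cheb_map a b) x = 2 * (x - a) / (b - a) - 1"
proof (rule inv_into_f_eq)
  show "inj_on (cheb_map a b) {-1..1}"
    using cheb_map_bij_betw[OF assms(1)] by (rule bij_betw_imp_inj_on)
qed (use assms in \<open>auto simp: cheb_map_def field_simps\<close>)

definition cheb_T :: "nat \<Rightarrow> real \<Rightarrow> real" where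
  "cheb_T j t = cos (real j * arccos t)"

definition cheb_node :: "nat \<Rightarrow> nat \<Rightarrow> real" where
  "cheb_node n l = cos ((2 * real l - 1) * pi / (2 * real n))"

definition cheb_coeff :: "real \<Rightarrow> real \<Rightarrow> (real \<Rightarrow> real) \<Rightarrow> nat \<Rightarrow> nat \<Rightarrow> real" where
  "cheb_coeff a b f j n =
     2 / real n * (\<Sum>l=1..n. f (cheb_map a b (cheb_node n l)) * cheb_T j (cheb_node n l))"

definition cheb_series :: "real \<Rightarrow> real \<Rightarrow> nat \<Rightarrow> nat \<Rightarrow> (real \<Rightarrow> real) \<Rightarrow> real \<Rightarrow> real" where
  "cheb_series a b d n f x =
     cheb_coeff a b f 0 n / 2 +
     (\<Sum>j=1..d. cheb_coeff a b f j n * cheb_T j (inv_into {-1..1} (cheb_map a b) x))"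

end

theory Submission
  imports Defs
begin

text \<open>
  Substituting \<open>x = G (cos t)\<close>, with \<open>G\<close> the affine map of \<open>[-1, 1]\<close> onto \<open>[a, b]\<close>, turns
  Chebyshev coefficients into cosine coefficients. Integration by parts gives
  \<open>c\<^sub>j(f) = (b - a) / (4 j) (c\<^sub>j\<^sub>-\<^sub>1(f') - c\<^sub>j\<^sub>+\<^sub>1(f'))\<close>; it is used \<open>k\<close> times. The second
  mean value theorem, applied to a Jordan decomposition, bounds the coefficients of the last
  derivative by \<open>2 V / (\<pi> j)\<close>. The resulting decay is a binomial sum of reciprocals of falling factorials, whose
  tails telescope. Since the coefficients are absolutely summable, \<open>f\<close> is the sum of its Chebyshev
  series, so the error is \<open>\<Sum>\<^sub>p c\<^sub>p (T\<^sub>p - C T\<^sub>p)\<close> with \<open>C\<close> the truncated interpolation operator.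
  Discrete orthogonality at the nodes shows that \<open>C T\<^sub>p = T\<^sub>p\<close> for \<open>p \<le> d\<close> with \<open>p + d < 2 n\<close>, and that
  otherwise \<open>C T\<^sub>p\<close> has at most one (if \<open>d < n\<close>) or two (if \<open>d < 2 n\<close>) terms, each bounded by \<open>1\<close>.
\<close>

section \<open>Variation sums, the Jordan decomposition and differentiation of indefinite
  integrals\<close>

section \<open>Functions of bounded variation\<close>

text \<open>Appending one point to a partition is what makes the variation function finite on
  subintervals and lets it dominate the increments of \<open>g\<close>.\<close>

lemma variation_sums_extend:
  assumes s: "s \<in> variation_sums a x g" and "x < y"
  shows "s + \<bar>g y - g x\<bar> \<in> variation_sums a y g"
proof -
  obtain m :: nat and u :: "nat \<Rightarrow> real" where s_eq: "s = (\<Sum>i<m. \<bar>g (u (Suc i)) - g (u i)\<bar>)"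
    and u: "u 0 = a" "u m = x" "\<forall>i<m. u i < u (Suc i)"
    using s unfolding variation_sums_def by blast
  define w where "w = u(Suc m := y)"
  have "(\<Sum>i<Suc m. \<bar>g (w (Suc i)) - g (w i)\<bar>) = s + \<bar>g y - g x\<bar>"
    using u by (simp add: s_eq w_def)
  moreover have "w 0 = a" "w (Suc m) = y" "\<forall>i<Suc m. w i < w (Suc i)"
    using u \<open>x < y\<close> by (auto simp: w_def less_Suc_eq)
  ultimately show ?thesis
    unfolding variation_sums_def by (intro CollectI exI[of _ "Suc m"] exI[of _ w]) simp
qed

lemma variation_sums_refl: "0 \<in> variation_sums a a g"
proof -
  have "0 = (\<Sum>i<0. \<bar>g (a :: real) - g a\<bar>)" by simp
  then show ?thesis
    unfolding variation_sums_def
    by (intro CollectI exI[of _ "0::nat"] exI[of _ "\<lambda>_. a"]) simp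
qed

lemma variation_sums_nonempty: "a \<le> x \<Longrightarrow> variation_sums a x g \<noteq> {}"
  using variation_sums_refl[of a g] variation_sums_extend[OF variation_sums_refl, of a x g]
  by (cases "a = x") auto

text \<open>Jordan decomposition with \<open>(v + g) / 2\<close> and \<open>(v - g) / 2\<close>,
  where \<open>v\<close> is the variation function. With these halves the two total rises add up to
  \<open>v b - v a\<close>, so the coefficient bound later carries the total variation itself and
  not a multiple of it.\<close>

lemma bounded_variation_imp_mono_diff:
  assumes "a \<le> b" and bv: "bounded_variation a b g"
  obtains p q where "mono_on {a..b} p" "mono_on {a..b} q" "\<And>x. x \<in> {a..b} \<Longrightarrow> g x = p x - q x"
    "(p b - p a) + (q b - q a) \<le> total_variation a b g"
proof -
  define v where "v x = total_variation a x g" for x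
  have bdd: "bdd_above (variation_sums a x g)" if "x \<in> {a..b}" for x
  proof (cases "x = b")
    case False
    then show ?thesis
      using variation_sums_extend[of _ a x g b] bv that
      unfolding bounded_variation_def bdd_above_def by (smt (verit) atLeastAtMost_iff)
  qed (use bv in \<open>simp add: bounded_variation_def\<close>)
  have v_mono: "v x + \<bar>g y - g x\<bar> \<le> v y" if "x \<in> {a..b}" "y \<in> {a..b}" "x \<le> y" for x y
  proof (cases "x = y")
    case False
    have "v x \<le> v y - \<bar>g y - g x\<bar>"
      unfolding v_def total_variation_def
    proof (rule cSup_least)
      show "variation_sums a x g \<noteq> {}" using that by (intro variation_sums_nonempty) auto
    next
      fix s assume "s \<in> variation_sums a x g"
      then have "s + \<bar>g y - g x\<bar> \<le> Sup (variation_sums a y g)"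
        using that False by (intro cSup_upper bdd variation_sums_extend) auto
      then show "s \<le> Sup (variation_sums a y g) - \<bar>g y - g x\<bar>" by simp
    qed
    then show ?thesis by simp
  qed simp
  have "0 \<le> v a"
    unfolding v_def total_variation_def
    using \<open>a \<le> b\<close> by (intro cSup_upper bdd variation_sums_refl) auto
  show ?thesis
  proof (rule that[of "\<lambda>x. (v x + g x) / 2" "\<lambda>x. (v x - g x) / 2"])
    show "mono_on {a..b} (\<lambda>x. (v x + g x) / 2)" "mono_on {a..b} (\<lambda>x. (v x - g x) / 2)"
      by (intro mono_onI; use v_mono in fastforce)+
    show "(v b + g b) / 2 - (v a + g a) / 2 + ((v b - g b) / 2 - (v a - g a) / 2)
        \<le> total_variation a b g"
      using \<open>0 \<le> v a\<close> by (simp add: v_def field_simps)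
  qed (simp add: field_simps)
qed

section \<open>Calculus with countably many exceptional points\<close>

text \<open>
  After tilting \<open>w\<close> by a small slope, choose a level \<open>y\<close> outside the countable image of \<open>S\<close>: at the
  last point where \<open>y\<close> is attained the tilted function has a negative derivative, yet lies above \<open>y\<close>
  afterwards.
\<close>

lemma zero_derivative_off_countable_imp_le:
  fixes w :: "real \<Rightarrow> real"
  assumes "a \<le> b" and cont: "continuous_on {a..b} w" and "countable S"
    and deriv: "\<And>x. x \<in> {a<..<b} - S \<Longrightarrow> (w has_real_derivative 0) (at x)"
  shows "w b \<le> w a"
proof (rule ccontr)
  assume "\<not> w b \<le> w a"
  then have "a < b" using \<open>a \<le> b\<close> by (cases "a = b") auto
  \<comment> \<open>Half the mean slope: the tilted function still rises from \<open>a\<close> to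
    \<open>b\<close>, while its derivative off \<open>S\<close> is \<open>- e\<close>.\<close>
  define e where "e = (w b - w a) / (2 * (b - a))"
  have "e > 0" using \<open>a < b\<close> \<open>\<not> w b \<le> w a\<close> by (simp add: e_def)
  define z where "z x = w x - e * (x - a)" for x
  have contz: "continuous_on {a..b} z"
    unfolding z_def by (intro continuous_intros cont)
  have "e * (b - a) = (w b - w a) / 2" using \<open>a < b\<close> by (simp add: e_def divide_simps)
  then have "z b = w b - (w b - w a) / 2" by (simp add: z_def)
  then have "z a < z b" using \<open>\<not> w b \<le> w a\<close> by (simp add: z_def field_simps)
  moreover have "countable (z ` S)" using \<open>countable S\<close> by simp
  ultimately obtain y where y: "z a < y" "y < z b" "y \<notin> z ` S"
    using open_minus_countable[of "z ` S" "{z a<..<z b}"] by auto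
  define X where "X = {x \<in> {a..b}. z x \<le> y}"
  have clX: "compact X"
  proof -
    have "X = {a..b} \<inter> z -` {..y}" by (auto simp: X_def)
    then show ?thesis
      using continuous_closed_preimage[OF contz closed_atLeastAtMost closed_atMost[of y]]
      by (metis compact_Icc compact_Int_closed inf.left_idem)
  qed
  moreover have "a \<in> X" using y \<open>a < b\<close> by (simp add: X_def)
  ultimately obtain c where c: "c \<in> X" "\<And>x. x \<in> X \<Longrightarrow> x \<le> c"
    using compact_attains_sup[of X] by blast
  have "c < b" using c y by (cases "c = b") (auto simp: X_def)
  have above: "z x > y" if "c < x" "x \<le> b" for x
  proof (rule ccontr)
    assume "\<not> z x > y"
    then have "x \<in> X" using c that by (simp add: X_def)
    then show False using c(2)[of x] that by simp
  qed
  have "z c = y"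
  proof (rule ccontr)
    assume "z c \<noteq> y"
    then have "z c \<le> y" "y \<le> z b" using c y by (auto simp: X_def)
    moreover have "continuous_on {c..b} z"
      by (rule continuous_on_subset[OF contz]) (use c in \<open>auto simp: X_def\<close>)
    ultimately obtain x where x: "c \<le> x" "x \<le> b" "z x = y"
      using IVT'[of z c y b] \<open>c < b\<close> by auto
    then show False using above[of x] \<open>z c \<noteq> y\<close> by (cases "x = c") auto
  qed
  then have "a < c" "c \<notin> S" using y c by (auto simp: X_def order.order_iff_strict)
  then have "(w has_real_derivative 0) (at c)" using \<open>c < b\<close> by (intro deriv) auto
  then have "(z has_real_derivative 0 - e * 1) (at c)"
    unfolding z_def by (auto intro!: derivative_eq_intros)
  then obtain d where d: "d > 0" "\<And>h. h > 0 \<Longrightarrow> h < d \<Longrightarrow> z (c + h) < z c"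
    using DERIV_neg_dec_right[of z "0 - e * 1" c] \<open>e > 0\<close> by auto
  define h where "h = min (d / 2) (b - c)"
  have "0 < h" "h < d" "c + h \<le> b" using d \<open>c < b\<close> by (auto simp: h_def)
  then show False using d(2)[of h] above[of "c + h"] \<open>z c = y\<close> by auto
qed

text \<open>The difference \<open>w\<close> between \<open>F\<close> and the indefinite integral of
  \<open>f\<close> is continuous with derivative 0 off \<open>S\<close>; the preceding lemma applies
  to \<open>w\<close> and to \<open>- w\<close>.\<close>

lemma fundamental_theorem_of_calculus_countable:
  fixes F f :: "real \<Rightarrow> real"
  assumes "a \<le> b" and cont: "continuous_on {a..b} F" and f: "f integrable_on {a..b}"
    and S: "countable S"
    and deriv: "\<And>x. x \<in> {a<..<b} - S \<Longrightarrow> (F has_real_derivative f x) (at x) \<and> isCont f x"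
  shows "(f has_integral (F b - F a)) {a..b}"
proof -
  define w where "w x = F x - integral {a..x} f" for x
  have contw: "continuous_on {a..b} w"
    unfolding w_def by (intro continuous_intros cont indefinite_integral_continuous_1 f)
  have derivw: "(w has_real_derivative 0) (at x)" if x: "x \<in> {a<..<b} - S" for x
  proof -
    have "((\<lambda>u. integral {a..u} f) has_vector_derivative f x) (at x within ({a..b} - {}))"
      using deriv[OF x] x by (intro integral_has_vector_derivative_continuous_at f)
        (auto intro: continuous_at_imp_continuous_within)
    then have "((\<lambda>u. integral {a..u} f) has_real_derivative f x) (at x)"
      using x by (simp add: has_real_derivative_iff_has_vector_derivative at_within_Icc_at)
    then show ?thesis
      using DERIV_diff[of F "f x" x UNIV] deriv[OF x] unfolding w_def by fastforce
  qed
  have "w b \<le> w a"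
    by (rule zero_derivative_off_countable_imp_le[OF \<open>a \<le> b\<close> contw S derivw])
  moreover have "- w b \<le> - w a"
    using DERIV_minus[OF derivw]
    by (intro zero_derivative_off_countable_imp_le[OF \<open>a \<le> b\<close> _ S] continuous_intros contw) auto
  ultimately have "integral {a..b} f = F b - F a" by (simp add: w_def)
  then show ?thesis using f by (simp add: has_integral_iff)
qed

text \<open>The integrals in \<open>bv_derivatives\<close> refer to \<open>lborel\<close>, so
  integrability for the completed measure is transferred by Borel measurability of monotone
  functions.\<close>

lemma set_integrable_mono_on:
  assumes "mono_on {a..b} p"
  shows "set_integrable lborel {a..b} (p :: real \<Rightarrow> real)"
proof -
  have "integrable lebesgue (\<lambda>x. indicator {a..b} x *\<^sub>R p x)"
    using integrable_mono_on[OF assms] by (simp add: integrable_restrict_space)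
  moreover have "(\<lambda>x. indicator {a..b} x *\<^sub>R p x) \<in> borel_measurable lborel"
    using borel_measurable_mono_on_fnc[OF assms] by (simp add: borel_measurable_restrict_space_iff)
  ultimately show ?thesis unfolding set_integrable_def by (simp add: integrable_completion)
qed

text \<open>A weak derivative is a genuine one wherever it is continuous, and the two monotone parts
  of \<open>g\<close> have only countably many discontinuities.\<close>

lemma bounded_variation_indefinite_integral_deriv:
  assumes "a < b" and bv: "bounded_variation a b g"
    and u: "\<And>x y. x \<in> {a..b} \<Longrightarrow> y \<in> {a..b} \<Longrightarrow> u y - u x = (LBINT t=x..y. g t)"
  obtains S where "countable S"
    "\<And>x. x \<in> {a<..<b} - S \<Longrightarrow> (u has_real_derivative g x) (at x) \<and> isCont g x"
proof -
  obtain p q where p: "mono_on {a..b} p" and q: "mono_on {a..b} q"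
    and g: "\<And>x. x \<in> {a..b} \<Longrightarrow> g x = p x - q x"
    using bounded_variation_imp_mono_diff[OF less_imp_le[OF \<open>a < b\<close>] bv] by blast
  have "set_integrable lborel {a..b} (\<lambda>x. p x - q x)"
    by (intro set_integral_diff set_integrable_mono_on p q)
  then have g_int: "set_integrable lborel {a..b} g"
    by (rule set_integrable_cong[THEN iffD1, rotated -1]) (auto simp: g)
  have u_eq: "u x = u a + integral {a..x} g" if "x \<in> {a..b}" for x
  proof -
    have "set_integrable lborel {a..x} g"
      using that by (intro set_integrable_subset[OF g_int]) auto
    then have "(LBINT t=a..x. g t) = integral {a..x} g"
      using that by (intro interval_integral_eq_integral) auto
    then show ?thesis using u[of a x] that by simp
  qed
  define S where "S = {x \<in> {a<..<b}. \<not> isCont p x} \<union> {x \<in> {a<..<b}. \<not> isCont q x}"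
  have sub: "{a<..<b} \<subseteq> {a..b}" by auto
  have "countable S"
    unfolding S_def
    by (intro countable_Un mono_on_ctble_discont_open open_greaterThanLessThan
        mono_on_subset[OF p sub] mono_on_subset[OF q sub])
  moreover have "(u has_real_derivative g x) (at x) \<and> isCont g x" if x: "x \<in> {a<..<b} - S" for x
  proof
    have "isCont (\<lambda>x. p x - q x) x" using x by (intro continuous_intros) (auto simp: S_def)
    moreover have "eventually (\<lambda>y. g y = p y - q y) (nhds x)"
      using eventually_nhds_in_open[of "{a<..<b}" x] x by (auto elim!: eventually_mono simp: g)
    ultimately show cont: "isCont g x" by (simp add: isCont_cong)
    have "((\<lambda>y. integral {a..y} g) has_vector_derivative g x) (at x within ({a..b} - {}))"
      using x cont set_borel_integral_eq_integral(1)[OF g_int]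
      by (intro integral_has_vector_derivative_continuous_at) (auto intro: continuous_at_imp_continuous_within)
    then have "((\<lambda>y. integral {a..y} g) has_real_derivative g x) (at x)"
      using x by (simp add: has_real_derivative_iff_has_vector_derivative at_within_Icc_at)
    then have "((\<lambda>y. u a + integral {a..y} g) has_real_derivative g x) (at x)"
      by (auto intro!: derivative_eq_intros)
    then show "(u has_real_derivative g x) (at x)"
      by (rule has_field_derivative_transform_within_open[where S = "{a<..<b}"]) (use x in \<open>auto intro!: u_eq[symmetric]\<close>)
  qed
  ultimately show ?thesis using that by blast
qed

text \<open>Families consisting of a single interval suffice.\<close>

lemma absolutely_continuous_imp_continuous_on:
  assumes "absolutely_continuous_on_interval a b g"
  shows "continuous_on {a..b} g"
proof -
  have *: "\<exists>d>0. \<forall>u v. a \<le> u \<and> u \<le> v \<and> v \<le> b \<and> v - u < d \<longrightarrow> \<bar>g v - g u\<bar> < e" if "e > 0" for e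
  proof -
    obtain d where d: "d > 0" "\<And>(m::nat) u v. (\<forall>i<m. a \<le> u i \<and> u i \<le> v i \<and> v i \<le> b) \<Longrightarrow>
        disjoint_family_on (\<lambda>i. {u i<..<v i}) {..<m} \<Longrightarrow> (\<Sum>i<m. v i - u i) < d \<Longrightarrow>
        (\<Sum>i<m. \<bar>g (v i) - g (u i)\<bar>) < e"
      using assms \<open>e > 0\<close> unfolding absolutely_continuous_on_interval_def by meson
    have "\<bar>g v - g u\<bar> < e" if "a \<le> u" "u \<le> v" "v \<le> b" "v - u < d" for u v
      using d(2)[of 1 "\<lambda>_. u" "\<lambda>_. v"] that by (simp add: disjoint_family_on_def)
    with d(1) show ?thesis by blast
  qed
  show ?thesis
    unfolding continuous_on_iff
  proof (intro ballI allI impI)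
    fix x e :: real assume x: "x \<in> {a..b}" and "e > 0"
    then obtain d where "d > 0" and d: "\<And>u v. a \<le> u \<Longrightarrow> u \<le> v \<Longrightarrow> v \<le> b \<Longrightarrow> v - u < d \<Longrightarrow> \<bar>g v - g u\<bar> < e"
      using * by meson
    have "dist (g y) (g x) < e" if "y \<in> {a..b}" "dist y x < d" for y
      using d[of x y] d[of y x] x that by (cases "x \<le> y") (auto simp: dist_real_def abs_minus_commute)
    with \<open>d > 0\<close> show "\<exists>d>0. \<forall>y\<in>{a..b}. dist y x < d \<longrightarrow> dist (g y) (g x) < e" by blast
  qed
qed

section \<open>Chebyshev coefficients in the angle variable: size and integration by parts\<close>

section \<open>Cosine coefficients\<close>

text \<open>For \<open>g t = f (cheb_map a b (cos t))\<close> this is the exact Chebyshev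
  coefficient of \<open>f\<close>. The factor \<open>2 / pi\<close> is kept at \<open>j = 0\<close>,
  so the series starts with half of that coefficient.\<close>

definition cos_coeff :: "(real \<Rightarrow> real) \<Rightarrow> nat \<Rightarrow> real" where
  "cos_coeff g j = 2 / pi * integral {0..pi} (\<lambda>t. g t * cos (real j * t))"

lemma cheb_map_1: "cheb_map a b 1 = b"
  and cheb_map_minus_1: "cheb_map a b (-1) = a"
  by (simp_all add: cheb_map_def field_simps)

lemma cheb_map_cos_mem: "a < b \<Longrightarrow> cheb_map a b (cos t) \<in> {a..b}"
  using cheb_map_bij_betw[of a b] by (auto simp: bij_betw_def)

text \<open>The cosine decreases on \<open>[0, pi]\<close>, so \<open>\<phi>\<close>, with its minus
  sign, is nondecreasing and the second mean value theorem applies; it also yields integrability.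
  Since \<open>sin (real j * t)\<close> vanishes at both ends, only
  \<open>(\<phi> pi - \<phi> 0) * sin (real j * c) / j\<close> is left.\<close>

lemma mono_cos_coeff_bound:
  fixes p :: "real \<Rightarrow> real"
  assumes "a < b" and p: "mono_on {a..b} p"
  shows "(\<lambda>t. p (cheb_map a b (cos t)) * cos (real j * t)) integrable_on {0..pi}" (is "?h integrable_on _")
    and "j \<ge> 1 \<Longrightarrow> \<bar>integral {0..pi} (\<lambda>t. p (cheb_map a b (cos t)) * cos (real j * t))\<bar> \<le> (p b - p a) / real j"
proof -
  define \<phi> where "\<phi> t = - p (cheb_map a b (cos t))" for t
  have \<phi>_mono: "\<phi> s \<le> \<phi> t" if "0 \<le> s" "s \<le> t" "t \<le> pi" for s t
  proof -
    have "cos t \<le> cos s" using that by (intro cos_monotone_0_pi_le)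
    then have "cheb_map a b (cos t) \<le> cheb_map a b (cos s)"
      using \<open>a < b\<close> by (simp add: cheb_map_def)
    then show ?thesis
      unfolding \<phi>_def using cheb_map_cos_mem[OF \<open>a < b\<close>] by (simp add: mono_onD[OF p])
  qed
  have cos_int: "(\<lambda>t. cos (real j * t)) integrable_on {0..pi}"
    by (intro integrable_continuous_real continuous_intros)
  obtain c where c: "c \<in> {0..pi}" and
    int: "((\<lambda>t. \<phi> t * cos (real j * t)) has_integral
      (\<phi> 0 * integral {0..c} (\<lambda>t. cos (real j * t)) + \<phi> pi * integral {c..pi} (\<lambda>t. cos (real j * t)))) {0..pi}"
    by (rule second_mean_value_theorem_full[OF cos_int pi_ge_zero \<phi>_mono])
  have int': "(?h has_integral - (\<phi> 0 * integral {0..c} (\<lambda>t. cos (real j * t))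
      + \<phi> pi * integral {c..pi} (\<lambda>t. cos (real j * t)))) {0..pi}"
    using has_integral_neg[OF int] by (simp add: \<phi>_def)
  then show "?h integrable_on {0..pi}" by blast
  assume "j \<ge> 1"
  have cos_int_eq: "integral {u..v} (\<lambda>t. cos (real j * t)) = sin (real j * v) / j - sin (real j * u) / j"
    if "u \<le> v" for u v
    using that \<open>j \<ge> 1\<close>
    by (intro integral_unique fundamental_theorem_of_calculus)
       (auto intro!: derivative_eq_intros simp: has_real_derivative_iff_has_vector_derivative[symmetric])
  have "integral {0..pi} ?h = (\<phi> pi - \<phi> 0) * sin (real j * c) / j"
    unfolding integral_unique[OF int'] using c cos_int_eq[of 0 c] cos_int_eq[of c pi]
    by (simp add: left_diff_distrib diff_divide_distrib)
  also have "\<phi> pi - \<phi> 0 = p b - p a" by (simp add: \<phi>_def cheb_map_1 cheb_map_minus_1)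
  also have "\<bar>(p b - p a) * sin (real j * c) / j\<bar> \<le> (p b - p a) / j"
  proof -
    have "p a \<le> p b" using \<open>a < b\<close> by (intro mono_onD[OF p]) auto
    then have "\<bar>(p b - p a) * sin (real j * c)\<bar> \<le> (p b - p a) * 1"
      unfolding abs_mult by (intro mult_mono) auto
    then show ?thesis using \<open>j \<ge> 1\<close> by (simp add: divide_right_mono)
  qed
  finally show "\<bar>integral {0..pi} ?h\<bar> \<le> (p b - p a) / j" .
qed

text \<open>The bounds for the two monotone parts add up. Integrability is stated for
  \<open>j = 0\<close> as well, because integration by parts at order 1 produces a coefficient of
  order 0.\<close>

lemma bounded_variation_cos_coeff:
  assumes "a < b" and bv: "bounded_variation a b g"
  shows "(\<lambda>t. g (cheb_map a b (cos t)) * cos (real j * t)) integrable_on {0..pi}"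
    and "j \<ge> 1 \<Longrightarrow> \<bar>cos_coeff (\<lambda>t. g (cheb_map a b (cos t))) j\<bar>
      \<le> 2 * total_variation a b g / (pi * real j)"
proof -
  obtain p q where p: "mono_on {a..b} p" and q: "mono_on {a..b} q"
    and g: "\<And>x. x \<in> {a..b} \<Longrightarrow> g x = p x - q x"
    and V: "(p b - p a) + (q b - q a) \<le> total_variation a b g"
    using bounded_variation_imp_mono_diff[OF less_imp_le[OF \<open>a < b\<close>] bv] by blast
  define c where "c t = cheb_map a b (cos t)" for t
  note pj = mono_cos_coeff_bound[OF \<open>a < b\<close> p, of j, folded c_def]
  note qj = mono_cos_coeff_bound[OF \<open>a < b\<close> q, of j, folded c_def]
  have eq: "(\<lambda>t. g (c t) * cos (real j * t)) = (\<lambda>t. p (c t) * cos (real j * t) - q (c t) * cos (real j * t))"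
    unfolding c_def by (simp add: g[OF cheb_map_cos_mem[OF \<open>a < b\<close>]] left_diff_distrib)
  show "(\<lambda>t. g (cheb_map a b (cos t)) * cos (real j * t)) integrable_on {0..pi}"
    unfolding c_def[symmetric] eq by (intro integrable_diff pj qj)
  assume j: "j \<ge> 1"
  have "\<bar>integral {0..pi} (\<lambda>t. g (c t) * cos (real j * t))\<bar> \<le> (p b - p a) / j + (q b - q a) / j"
    unfolding eq integral_diff[OF pj(1) qj(1)] using pj(2)[OF j] qj(2)[OF j] by linarith
  also have "\<dots> \<le> total_variation a b g / j"
    using V by (simp add: add_divide_distrib[symmetric] divide_right_mono)
  finally have "2 / pi * \<bar>integral {0..pi} (\<lambda>t. g (c t) * cos (real j * t))\<bar>
      \<le> 2 / pi * (total_variation a b g / j)"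
    by (intro mult_left_mono) auto
  then show "\<bar>cos_coeff (\<lambda>t. g (cheb_map a b (cos t))) j\<bar> \<le> 2 * total_variation a b g / (pi * real j)"
    by (simp add: cos_coeff_def c_def abs_mult)
qed

text \<open>The derivative of \<open>g t * sin (real j * t)\<close> is integrated in two ways: the
  boundary values vanish, and the product of two sines splits into cosines of the neighbouring
  orders. In the application \<open>w\<close> is the slope \<open>(b - a) / 2\<close> of
  \<open>cheb_map\<close>.\<close>

lemma cos_coeff_by_parts:
  assumes cont: "continuous_on {0..pi} g" and "countable S"
    and deriv: "\<And>t. t \<in> {0<..<pi} - S \<Longrightarrow>
      (g has_real_derivative - (w * sin t * g' t)) (at t) \<and> isCont g' t"
    and int: "\<And>m::nat. (\<lambda>t. g' t * cos (real m * t)) integrable_on {0..pi}"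
    and "j \<ge> 1"
  shows "cos_coeff g j = w / (2 * real j) * (cos_coeff g' (j - 1) - cos_coeff g' (j + 1))"
proof -
  define I where "I m = integral {0..pi} (\<lambda>t. g' t * cos (real m * t))" for m :: nat
  define J where "J = integral {0..pi} (\<lambda>t. g t * cos (real j * t))"
  \<comment> \<open>Off \<open>S\<close> this is the derivative of
    \<open>g t * sin (real j * t)\<close>, with the product of sines already split as in
    \<open>trig\<close>.\<close>
  define f where "f t = - w / 2 * (g' t * cos (real (j - 1) * t) - g' t * cos (real (j + 1) * t))
      + real j * (g t * cos (real j * t))" for t
  have trig: "sin t * sin (real j * t) = (cos (real (j - 1) * t) - cos (real (j + 1) * t)) / 2" for t
    using \<open>j \<ge> 1\<close> sin_times_sin[of "real j * t" t] by (simp add: of_nat_diff algebra_simps)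
  have g_int: "(\<lambda>t. g t * cos (real j * t)) integrable_on {0..pi}"
    by (intro integrable_continuous_real continuous_intros cont)
  have "(f has_integral (- w / 2 * (I (j - 1) - I (j + 1)) + real j * J)) {0..pi}"
    unfolding f_def I_def J_def
    by (intro has_integral_add has_integral_mult_right has_integral_diff integrable_integral int g_int)
  moreover have "(f has_integral (g pi * sin (real j * pi) - g 0 * sin (real j * 0))) {0..pi}"
  proof (rule fundamental_theorem_of_calculus_countable[where S = S])
    show "f integrable_on {0..pi}" using calculation by (rule has_integral_integrable)
    show "continuous_on {0..pi} (\<lambda>t. g t * sin (real j * t))" by (intro continuous_intros cont)
    fix t assume t: "t \<in> {0<..<pi} - S"
    have eq: "f t = - (w * sin t * g' t) * sin (real j * t) + (cos (real j * t) * real j) * g t"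
    proof -
      have "w * sin t * g' t * sin (real j * t) = w * g' t * (sin t * sin (real j * t))" by simp
      then show ?thesis unfolding f_def trig by (simp add: algebra_simps)
    qed
    have "((\<lambda>t. sin (real j * t)) has_real_derivative (cos (real j * t) * real j)) (at t)"
      by (auto intro!: derivative_eq_intros)
    then have 1: "((\<lambda>t. g t * sin (real j * t)) has_real_derivative f t) (at t)"
      unfolding eq using deriv[OF t] by (intro DERIV_mult) auto
    have "isCont g t" using deriv[OF t] DERIV_isCont by blast
    then have "isCont f t"
      unfolding f_def using deriv[OF t] by (intro continuous_intros) auto
    with 1 show "((\<lambda>t. g t * sin (real j * t)) has_real_derivative f t) (at t) \<and> isCont f t" by blast
  qed (use \<open>countable S\<close> in auto)
  ultimately have "- w / 2 * (I (j - 1) - I (j + 1)) + real j * J =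
      g pi * sin (real j * pi) - g 0 * sin (real j * 0)"
    by (rule has_integral_unique)
  then have "- w / 2 * (I (j - 1) - I (j + 1)) + real j * J = 0" by simp
  then have "J = w / (2 * real j) * (I (j - 1) - I (j + 1))"
    using \<open>j \<ge> 1\<close> by (simp add: field_simps)
  then have "2 / pi * J = w / (2 * real j) * (2 / pi * I (j - 1) - 2 / pi * I (j + 1))"
    by (simp only: right_diff_distrib mult.left_commute)
  then show ?thesis unfolding cos_coeff_def I_def J_def .
qed

text \<open>The substitution is injective on \<open>[0, pi]\<close>, so the preimage of a countable
  exceptional set is again countable; the rest is the chain rule.\<close>

lemma cheb_map_cos_has_derivative:
  assumes "a < b" and S: "countable S"
    and deriv: "\<And>x. x \<in> {a<..<b} - S \<Longrightarrow> (u has_real_derivative g x) (at x) \<and> isCont g x"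
  obtains S' where "countable S'" "\<And>t. t \<in> {0<..<pi} - S' \<Longrightarrow>
      ((\<lambda>t. u (cheb_map a b (cos t))) has_real_derivative
        - ((b - a) / 2 * sin t * g (cheb_map a b (cos t)))) (at t) \<and>
      isCont (\<lambda>t. g (cheb_map a b (cos t))) t"
proof -
  define c where "c t = cheb_map a b (cos t)" for t
  define S' where "S' = {t \<in> {0<..<pi}. c t \<in> S}"
  have "inj_on c S'"
  proof (rule inj_onI)
    fix s t assume "s \<in> S'" "t \<in> S'" "c s = c t"
    then show "s = t"
      using \<open>a < b\<close> cos_inj_pi[of s t] by (auto simp: S'_def c_def cheb_map_def)
  qed
  moreover have "countable (c ` S')" by (rule countable_subset[OF _ S]) (auto simp: S'_def)
  ultimately have "countable S'" using countable_image_inj_on by blast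
  moreover have "((\<lambda>t. u (c t)) has_real_derivative - ((b - a) / 2 * sin t * g (c t))) (at t) \<and>
      isCont (\<lambda>t. g (c t)) t" if t: "t \<in> {0<..<pi} - S'" for t
  proof -
    have "cos t < cos 0" "cos pi < cos t" using t by (intro cos_monotone_0_pi; simp)+
    then have "(b - a) / 2 * 0 < (b - a) / 2 * (cos t + 1)" "(b - a) / 2 * (cos t + 1) < (b - a) / 2 * 2"
      using \<open>a < b\<close> by (intro mult_strict_left_mono; simp)+
    then have "c t \<in> {a<..<b} - S" using t by (auto simp: c_def cheb_map_def S'_def)
    note D = deriv[OF this]
    have c_deriv: "(c has_real_derivative - ((b - a) / 2 * sin t)) (at t)"
      unfolding c_def cheb_map_def by (auto intro!: derivative_eq_intros)
    have "((\<lambda>t. u (c t)) has_real_derivative g (c t) * - ((b - a) / 2 * sin t)) (at t)"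
      by (rule DERIV_chain2[OF conjunct1[OF D] c_deriv])
    moreover have "isCont (\<lambda>t. g (c t)) t"
      by (rule isCont_o2[OF DERIV_isCont[OF c_deriv] conjunct2[OF D]])
    ultimately show ?thesis by (simp add: mult_ac)
  qed
  ultimately show ?thesis using that unfolding c_def by blast
qed

section \<open>Orthogonality and completeness of the cosines\<close>

section \<open>Convergence of the cosine series\<close>

text \<open>Integer frequencies let the product formula use \<open>p - j\<close> without comparing
  \<open>p\<close> and \<open>j\<close>.\<close>

lemma has_integral_cos_int:
  "((\<lambda>t. cos (real_of_int m * t)) has_integral (if m = 0 then pi else 0)) {0..pi}"
proof (cases "m = 0")
  case True
  then show ?thesis using has_integral_const_real[of "1::real" 0 pi] by simp
next
  case False
  have "((\<lambda>t. cos (real_of_int m * t)) has_integral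
      (sin (real_of_int m * pi) / m - sin (real_of_int m * 0) / m)) {0..pi}"
    using False by (intro fundamental_theorem_of_calculus)
       (auto intro!: derivative_eq_intros simp: has_real_derivative_iff_has_vector_derivative[symmetric])
  moreover have "sin (real_of_int m * pi) = 0"
    using sin_zero_iff_int2 by blast
  ultimately show ?thesis using False by simp
qed

lemma has_integral_cos_cos:
  "((\<lambda>t. cos (real p * t) * cos (real j * t)) has_integral
     (if p = j then if j = 0 then pi else pi / 2 else 0)) {0..pi}"
proof -
  have eq: "(\<lambda>t. cos (real p * t) * cos (real j * t)) =
      (\<lambda>t. (cos (real_of_int (int p - int j) * t) + cos (real_of_int (int p + int j) * t)) / 2)"
    by (simp add: cos_times_cos left_diff_distrib distrib_right)
  show ?thesis
    unfolding eq
    by (rule has_integral_eq_rhs[OF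
          has_integral_divide[OF has_integral_add[OF has_integral_cos_int has_integral_cos_int]]]) auto
qed

text \<open>Vanishing cosine moments make \<open>r\<close> orthogonal to every polynomial in
  \<open>cos t\<close>. By Weierstrass approximation of \<open>r\<close> composed with
  \<open>arccos\<close>, the integral of \<open>r t * r t\<close> is then at most any positive
  multiple of the integral of \<open>\<bar>r t\<bar>\<close>, hence 0.\<close>

lemma cos_moments_zero:
  fixes r :: "real \<Rightarrow> real"
  assumes cont: "continuous_on {0..pi} r"
    and zero: "\<And>j::nat. integral {0..pi} (\<lambda>t. r t * cos (real j * t)) = 0"
    and "t \<in> {0..pi}"
  shows "r t = 0"
proof -
  \<comment> \<open>Carrying the extra factor \<open>cos (real j * t)\<close> for all
    \<open>j\<close> closes the induction: one more factor \<open>cos t\<close> only moves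
    \<open>j\<close> to its neighbours.\<close>
  have moments: "((\<lambda>t. r t * cos t ^ m * cos (real j * t)) has_integral 0) {0..pi}" for m j :: nat
  proof (induction m arbitrary: j)
    case 0
    have "(\<lambda>t. r t * cos (real j * t)) integrable_on {0..pi}"
      by (intro integrable_continuous_real continuous_intros cont)
    then show ?case using zero[of j] by (simp add: has_integral_iff)
  next
    case (Suc m)
    show ?case
    proof (cases j)
      case 0
      then show ?thesis using Suc[of 1] by (simp add: mult_ac)
    next
      case (Suc i)
      have trig: "cos t * cos (real j * t) = (cos (real (j + 1) * t) + cos (real i * t)) / 2" for t
        using cos_times_cos[of "real j * t" t] by (simp add: Suc algebra_simps)
      have "r t * cos t ^ Suc m * cos (real j * t) =
         r t * cos t ^ m * ((cos (real (j + 1) * t) + cos (real i * t)) / 2)" for t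
        unfolding trig[symmetric] by (simp only: power_Suc mult_ac)
      then have eq: "r t * cos t ^ Suc m * cos (real j * t) =
         (r t * cos t ^ m * cos (real (j + 1) * t) + r t * cos t ^ m * cos (real i * t)) / 2" for t
        by (simp only: distrib_left times_divide_eq_right)
      show ?thesis
        unfolding eq
        using has_integral_divide[OF has_integral_add[OF Suc.IH[of "j + 1"] Suc.IH[of i]], of 2] by simp
    qed
  qed
  define R where "R x = r (arccos x)" for x
  have contR: "continuous_on {-1..1} R"
    unfolding R_def
    by (rule continuous_on_compose2[OF cont]) (auto intro!: continuous_intros arccos_lbound arccos_ubound)
  have r_int: "(\<lambda>t. \<bar>r t\<bar>) integrable_on {0..pi}" and r2_int: "(\<lambda>t. r t * r t) integrable_on {0..pi}"
    by (intro integrable_continuous_real continuous_intros cont)+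
  have bound: "integral {0..pi} (\<lambda>t. r t * r t) \<le> e * integral {0..pi} (\<lambda>t. \<bar>r t\<bar>)" if "e > 0" for e
  proof -
    obtain q where q: "real_polynomial_function q" "\<And>x. x \<in> {-1..1} \<Longrightarrow> \<bar>R x - q x\<bar> < e"
      using Stone_Weierstrass_real_polynomial_function[OF compact_Icc contR \<open>e > 0\<close>] by blast
    then obtain \<alpha> N where q_eq: "q = (\<lambda>x. \<Sum>i\<le>N. \<alpha> i * x ^ i)"
      using real_polynomial_function_iff_sum by blast
    have "((\<lambda>t. \<Sum>i\<le>N. \<alpha> i * (r t * cos t ^ i * cos (real 0 * t))) has_integral (\<Sum>i\<le>N. \<alpha> i * 0)) {0..pi}"
      by (intro has_integral_sum has_integral_mult_right moments finite_atMost)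
    then have rq: "((\<lambda>t. r t * q (cos t)) has_integral 0) {0..pi}"
      by (simp add: q_eq sum_distrib_left mult_ac)
    have "integral {0..pi} (\<lambda>t. r t * r t) = integral {0..pi} (\<lambda>t. r t * r t - r t * q (cos t))"
      using r2_int rq by (subst integral_diff) (auto simp: has_integral_iff)
    also have "\<dots> \<le> integral {0..pi} (\<lambda>t. e * \<bar>r t\<bar>)"
    proof (rule integral_le)
      show "(\<lambda>t. r t * r t - r t * q (cos t)) integrable_on {0..pi}"
        using r2_int rq by (intro integrable_diff) auto
      show "(\<lambda>t. e * \<bar>r t\<bar>) integrable_on {0..pi}"
        using r_int by (intro integrable_on_mult_right)
      fix t assume t: "t \<in> {0..pi}"
      have "\<bar>r t - q (cos t)\<bar> < e" using q(2)[of "cos t"] t by (simp add: R_def arccos_cos)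
      then have "\<bar>r t\<bar> * \<bar>r t - q (cos t)\<bar> \<le> \<bar>r t\<bar> * e" by (intro mult_left_mono) auto
      moreover have "r t * r t - r t * q (cos t) \<le> \<bar>r t\<bar> * \<bar>r t - q (cos t)\<bar>"
        by (metis abs_ge_self abs_mult right_diff_distrib)
      ultimately show "r t * r t - r t * q (cos t) \<le> e * \<bar>r t\<bar>" by (simp add: mult.commute)
    qed
    finally show ?thesis by simp
  qed
  define C where "C = integral {0..pi} (\<lambda>t. \<bar>r t\<bar>)"
  have "C \<ge> 0" unfolding C_def by (intro integral_nonneg r_int) auto
  have "integral {0..pi} (\<lambda>t. r t * r t) \<le> 0"
  proof (rule field_le_epsilon)
    fix e :: real assume "e > 0"
    \<comment> \<open>Dividing by \<open>C + 1\<close> avoids a case distinction for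
      \<open>C = 0\<close>.\<close>
    have "integral {0..pi} (\<lambda>t. r t * r t) \<le> e / (C + 1) * C"
      unfolding C_def by (rule bound) (use \<open>e > 0\<close> \<open>C \<ge> 0\<close> in \<open>simp add: C_def\<close>)
    also have "\<dots> \<le> e" using \<open>e > 0\<close> \<open>C \<ge> 0\<close> by (simp add: field_simps)
    finally show "integral {0..pi} (\<lambda>t. r t * r t) \<le> 0 + e" by simp
  qed
  moreover have "integral {0..pi} (\<lambda>t. r t * r t) \<ge> 0"
    by (intro integral_nonneg r2_int) auto
  ultimately have "integral {0..pi} (\<lambda>t. r t * r t) = 0" by simp
  then have "\<forall>t\<in>{0..pi}. r t * r t = 0"
    by (subst (asm) integral_eq_0_iff) (auto intro!: continuous_intros cont)
  then show ?thesis using \<open>t \<in> {0..pi}\<close> by simp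
qed

text \<open>By the M-test the series converges uniformly to a continuous \<open>s\<close>.
  Integrating term by term shows that \<open>s\<close> has the same cosine moments as
  \<open>g\<close>, so \<open>g - s\<close> vanishes by \<open>cos_moments_zero\<close>.\<close>

lemma cos_series_sums:
  assumes cont: "continuous_on {0..pi} g"
    and summ: "summable (\<lambda>j. \<bar>cos_coeff g j\<bar>)"
    and t: "t \<in> {0..pi}"
  shows "(\<lambda>p. (if p = 0 then cos_coeff g 0 / 2 else cos_coeff g p) * cos (real p * t)) sums g t"
proof -
  define e where "e p = (if p = 0 then cos_coeff g 0 / 2 else cos_coeff g p)" for p
  define s where "s t = (\<Sum>p. e p * cos (real p * t))" for t
  have bd: "norm (e p * cos (real p * u)) \<le> \<bar>cos_coeff g p\<bar>" for p u
    using mult_left_le[of "\<bar>cos (real p * u)\<bar>" "\<bar>cos_coeff g p\<bar>"]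
    by (auto simp: e_def abs_mult)
  have unif: "uniform_limit {0..pi} (\<lambda>n u. \<Sum>p<n. e p * cos (real p * u)) s sequentially"
    unfolding s_def by (rule Weierstrass_m_test[OF bd summ])
  have s_cont: "continuous_on {0..pi} s"
    by (rule uniform_limit_theorem[OF _ unif]) (auto intro!: always_eventually continuous_intros)
  have s_coeff: "integral {0..pi} (\<lambda>u. s u * cos (real j * u)) = pi / 2 * cos_coeff g j" for j
  proof -
    have "uniform_limit {0..pi} (\<lambda>n u. (\<Sum>p<n. e p * cos (real p * u)) * cos (real j * u))
        (\<lambda>u. s u * cos (real j * u)) sequentially"
      by (intro uniform_lim_mult[OF unif uniform_limit_const] compact_imp_bounded
          compact_continuous_image s_cont compact_Icc continuous_intros)
    then obtain I L where I: "\<And>n. ((\<lambda>u. (\<Sum>p<n. e p * cos (real p * u)) * cos (real j * u)) has_integral I n) {0..pi}"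
      and L: "((\<lambda>u. s u * cos (real j * u)) has_integral L) {0..pi}" and lim: "I \<longlonglongrightarrow> L"
      by (rule uniform_limit_integral) (auto intro!: continuous_intros)
    have "I n = pi / 2 * cos_coeff g j" if "n > j" for n
    proof -
      have "((\<lambda>u. \<Sum>p<n. e p * (cos (real p * u) * cos (real j * u))) has_integral
         (\<Sum>p<n. e p * (if p = j then if j = 0 then pi else pi / 2 else 0))) {0..pi}"
        by (intro has_integral_sum has_integral_mult_right has_integral_cos_cos finite_lessThan)
      then have "I n = (\<Sum>p<n. e p * (if p = j then if j = 0 then pi else pi / 2 else 0))"
        using has_integral_unique[OF I[of n]] by (simp add: sum_distrib_right mult.assoc)
      \<comment> \<open>At \<open>j = 0\<close> the halved constant term in \<open>e\<close>
        compensates for the integral \<open>pi\<close> in place of \<open>pi / 2\<close>.\<close>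
      also have "\<dots> = (\<Sum>p<n. if p = j then pi / 2 * cos_coeff g j else 0)"
        by (intro sum.cong refl) (auto simp: e_def)
      finally show ?thesis using that by simp
    qed
    then have "I \<longlonglongrightarrow> pi / 2 * cos_coeff g j"
      by (intro tendsto_eventually) (auto simp: eventually_sequentially intro!: exI[of _ "Suc j"])
    then have "L = pi / 2 * cos_coeff g j" using lim LIMSEQ_unique by blast
    with L show ?thesis by blast
  qed
  have "g t - s t = 0"
  proof (rule cos_moments_zero[OF _ _ t])
    show "continuous_on {0..pi} (\<lambda>u. g u - s u)" by (intro continuous_intros cont s_cont)
    fix j :: nat
    have "integral {0..pi} (\<lambda>u. (g u - s u) * cos (real j * u)) =
       integral {0..pi} (\<lambda>u. g u * cos (real j * u)) - integral {0..pi} (\<lambda>u. s u * cos (real j * u))"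
      unfolding left_diff_distrib
      by (intro integral_diff integrable_continuous_real continuous_intros cont s_cont)
    also have "\<dots> = 0" by (simp add: s_coeff cos_coeff_def)
    finally show "integral {0..pi} (\<lambda>u. (g u - s u) * cos (real j * u)) = 0" .
  qed
  moreover have "(\<lambda>p. e p * cos (real p * t)) sums s t"
    unfolding s_def by (intro summable_sums summable_comparison_test'[OF summ bd])
  ultimately show ?thesis by (simp add: e_def)
qed

section \<open>The recurrence for the coefficient bounds and the telescoping of their tails\<close>

section \<open>Reciprocals of falling factorials\<close>

definition falling :: "real \<Rightarrow> nat \<Rightarrow> real" where
  "falling x m = (\<Prod>i<m. x - real i)"

lemma falling_Suc: "falling x (Suc m) = (x - real m) * falling x m"
  by (simp add: falling_def)

lemma falling_Suc': "falling (x + 1) (Suc m) = (x + 1) * falling x m"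
  unfolding falling_def prod.lessThan_Suc_shift by (simp add: algebra_simps)

lemma falling_pos: "real m < x + 1 \<Longrightarrow> falling x m > 0"
  unfolding falling_def by (intro prod_pos) auto

text \<open>
  \<open>decay m\<close> solves the recurrence \<open>x B\<^sub>m\<^sub>+\<^sub>1(x) = B\<^sub>m(x - 1) + B\<^sub>m(x + 1)\<close>, \<open>B\<^sub>0(x) = 1 / x\<close>, that iterated
  integration by parts imposes on the coefficient bounds.
\<close>

definition decay :: "nat \<Rightarrow> real \<Rightarrow> real" where
  "decay m x = (\<Sum>i\<le>m. real (m choose i) / falling (x + real i) (Suc m))"

lemma decay_0: "decay 0 x = 1 / x"
  by (simp add: decay_def falling_def)

text \<open>Absorption: \<open>(i + 1) * (m choose (i + 1)) = (m - i) * (m choose i)\<close>,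
  followed by an index shift. The summands lost or gained at the ends carry a factor 0.\<close>

lemma binomial_weighted_shift:
  "(\<Sum>i\<le>m. real (m choose i) * real i * Q i) =
   (\<Sum>i\<le>m. real (m choose i) * (real m - real i) * Q (Suc i))" for Q :: "nat \<Rightarrow> real"
proof (cases m)
  case (Suc r)
  have *: "real (Suc r choose Suc i) * real (Suc i) = real (Suc r choose i) * (real (Suc r) - real i)"
    if "i \<le> r" for i
  proof -
    have "Suc i * (Suc r choose Suc i) = (Suc r - i) * (Suc r choose i)"
      using that by (metis Suc_times_binomial_eq binomial_absorb_comp diff_Suc_1 mult.commute)
    then have "real (Suc i) * real (Suc r choose Suc i) = real (Suc r - i) * real (Suc r choose i)"
      by (metis of_nat_mult)
    then show ?thesis using that by (simp add: of_nat_diff mult.commute)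
  qed
  have "(\<Sum>i\<le>Suc r. real (Suc r choose i) * real i * Q i) =
      (\<Sum>i\<le>r. real (Suc r choose Suc i) * real (Suc i) * Q (Suc i))"
    by (subst sum.atMost_Suc_shift) simp
  also have "\<dots> = (\<Sum>i\<le>r. real (Suc r choose i) * (real (Suc r) - real i) * Q (Suc i))"
    by (intro sum.cong refl) (subst *, auto)
  also have "\<dots> = (\<Sum>i\<le>Suc r. real (Suc r choose i) * (real (Suc r) - real i) * Q (Suc i))"
    by simp
  finally show ?thesis by (simp add: Suc)
qed simp

text \<open>Pascal's rule under the sum; \<open>m choose Suc m = 0\<close> lets both sums have the
  same range.\<close>

lemma sum_binomial_Suc:
  "(\<Sum>i\<le>Suc m. real (Suc m choose i) * Q i) = (\<Sum>i\<le>m. real (m choose i) * (Q i + Q (Suc i)))"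
  for Q :: "nat \<Rightarrow> real"
proof -
  have "(\<Sum>i\<le>Suc m. real (Suc m choose i) * Q i) =
      Q 0 + (\<Sum>i\<le>m. real (m choose i) * Q (Suc i)) + (\<Sum>i\<le>m. real (m choose Suc i) * Q (Suc i))"
    by (subst sum.atMost_Suc_shift) (simp add: sum.distrib algebra_simps)
  also have "Q 0 + (\<Sum>i\<le>m. real (m choose Suc i) * Q (Suc i)) = (\<Sum>i\<le>Suc m. real (m choose i) * Q i)"
    by (subst sum.atMost_Suc_shift) simp
  then have "Q 0 + (\<Sum>i\<le>m. real (m choose i) * Q (Suc i)) + (\<Sum>i\<le>m. real (m choose Suc i) * Q (Suc i))
     = (\<Sum>i\<le>m. real (m choose i) * Q (Suc i)) + (\<Sum>i\<le>m. real (m choose i) * Q i)"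
    by simp
  finally show ?thesis by (simp add: sum.distrib algebra_simps)
qed

text \<open>Over the denominators of \<open>Q\<close> the two families have numerators
  \<open>x + i\<close> and \<open>x + i - m\<close>. The parts with \<open>x\<close> combine by
  Pascal's rule to \<open>x * decay (Suc m) x\<close>; the parts \<open>i\<close> and
  \<open>- (m - i)\<close> cancel by \<open>binomial_weighted_shift\<close>.\<close>

lemma decay_Suc:
  assumes x: "x > real (Suc m)"
  shows "x * decay (Suc m) x = decay m (x - 1) + decay m (x + 1)"
proof -
  define Q where "Q i = 1 / falling (x + real i) (Suc (Suc m))" for i
  have P: "1 / falling (x - 1 + real i) (Suc m) = (x + real i) * Q i" for i
  proof -
    have "falling (x + real i) (Suc (Suc m)) = (x + real i) * falling (x - 1 + real i) (Suc m)"
      using falling_Suc'[of "x - 1 + real i" "Suc m"] by (simp add: add.commute add_diff_eq)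
    moreover have "x + real i > 0" using x by simp
    ultimately show ?thesis by (simp add: Q_def)
  qed
  have P': "1 / falling (x + 1 + real i) (Suc m) = (x + real i - real m) * Q (Suc i)" for i
  proof -
    have "falling (x + real (Suc i)) (Suc (Suc m)) =
        (x + real i - real m) * falling (x + 1 + real i) (Suc m)"
      using falling_Suc[of "x + real (Suc i)" "Suc m"] by (simp add: algebra_simps)
    moreover have "x + real i - real m > 0" using x by simp
    ultimately show ?thesis by (simp add: Q_def)
  qed
  have "decay m (x - 1) + decay m (x + 1) =
      (\<Sum>i\<le>m. real (m choose i) * ((x + real i) * Q i + (x + real i - real m) * Q (Suc i)))"
    unfolding decay_def sum.distrib[symmetric]
    by (intro sum.cong refl) (simp add: distrib_left P[symmetric] P'[symmetric])
  also have "\<dots> = x * (\<Sum>i\<le>m. real (m choose i) * (Q i + Q (Suc i)))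
      + ((\<Sum>i\<le>m. real (m choose i) * real i * Q i)
         - (\<Sum>i\<le>m. real (m choose i) * (real m - real i) * Q (Suc i)))"
    unfolding sum_distrib_left sum_subtractf[symmetric] sum.distrib[symmetric]
    by (intro sum.cong refl) (simp add: algebra_simps)
  also have "\<dots> = x * (\<Sum>i\<le>m. real (m choose i) * (Q i + Q (Suc i)))"
    by (simp add: binomial_weighted_shift)
  also have "\<dots> = x * decay (Suc m) x"
    unfolding sum_binomial_Suc[symmetric] by (simp add: decay_def Q_def)
  finally show ?thesis by simp
qed

text \<open>Over the common denominator \<open>falling x (Suc m)\<close> the two fractions have
  numerators \<open>x\<close> and \<open>x - m\<close>, which differ by \<open>m\<close>.\<close>

lemma inverse_falling_telescope:
  assumes "m \<ge> 1" and "x > real m"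
  shows "1 / falling x (Suc m) = (1 / falling (x - 1) m - 1 / falling x m) / real m"
proof -
  have 1: "falling x (Suc m) = (x - real m) * falling x m" by (rule falling_Suc)
  have 2: "falling x (Suc m) = x * falling (x - 1) m" using falling_Suc'[of "x - 1" m] by simp
  have "1 / falling (x - 1) m = x / falling x (Suc m)"
    using 2 assms by simp
  moreover have "1 / falling x m = (x - real m) / falling x (Suc m)"
    using 1 assms by simp
  ultimately show ?thesis using \<open>m \<ge> 1\<close> by (simp add: diff_divide_distrib[symmetric])
qed

text \<open>Each summand of \<open>decay\<close> telescopes in \<open>p\<close> and the positive
  last term is dropped. The bound is uniform in \<open>N\<close>, so it serves both for summability
  and for the tail.\<close>

lemma sum_decay_le:
  assumes k: "k \<ge> 1" and M: "M > k"
  shows "(\<Sum>p<N. decay k (real (M + p)))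
    \<le> (\<Sum>i\<le>k. real (k choose i) / falling (real M - 1 + real i) k) / real k"
proof -
  have "(\<Sum>p<N. 1 / falling (real (M + p) + real i) (Suc k))
      \<le> 1 / falling (real M - 1 + real i) k / real k" for i
  proof -
    define r where "r p = 1 / falling (real M - 1 + real i + real p) k / real k" for p
    have "(\<Sum>p<N. 1 / falling (real (M + p) + real i) (Suc k)) = (\<Sum>p<N. r p - r (Suc p))"
      using M by (intro sum.cong refl)
        (subst inverse_falling_telescope[OF k], auto simp: r_def diff_divide_distrib algebra_simps)
    also have "\<dots> = r 0 - r N" by (rule sum_lessThan_telescope')
    also have "\<dots> \<le> r 0"
      using falling_pos[of k "real M - 1 + real i + real N"] M by (simp add: r_def)
    finally show ?thesis by (simp add: r_def)
  qed
  then have "(\<Sum>i\<le>k. real (k choose i) * (\<Sum>p<N. 1 / falling (real (M + p) + real i) (Suc k)))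
      \<le> (\<Sum>i\<le>k. real (k choose i) * (1 / falling (real M - 1 + real i) k / real k))"
    by (intro sum_mono mult_left_mono) auto
  moreover have "(\<Sum>p<N. decay k (real (M + p))) =
      (\<Sum>i\<le>k. real (k choose i) * (\<Sum>p<N. 1 / falling (real (M + p) + real i) (Suc k)))"
    unfolding decay_def sum_distrib_left by (subst sum.swap) simp
  ultimately show ?thesis by (simp add: sum_divide_distrib)
qed

section \<open>Discrete orthogonality and the image of a single Chebyshev polynomial\<close>

section \<open>Aliasing at the Chebyshev nodes\<close>

definition node_angle :: "nat \<Rightarrow> nat \<Rightarrow> real" where
  "node_angle n l = (2 * real l - 1) * pi / (2 * real n)"

text \<open>The frequency is an integer because aliasing involves both \<open>p + j\<close> and
  \<open>p - j\<close>.\<close>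

definition node_avg :: "nat \<Rightarrow> int \<Rightarrow> real" where
  "node_avg n q = (\<Sum>l=1..n. cos (of_int q * node_angle n l)) / real n"

lemma node_angle_mem: "l \<in> {1..n} \<Longrightarrow> node_angle n l \<in> {0..pi}"
proof -
  assume l: "l \<in> {1..n}"
  then have "(2 * real l - 1) * pi \<le> (2 * real n) * pi" by (intro mult_right_mono) auto
  with l show ?thesis by (simp add: node_angle_def divide_le_eq mult.commute)
qed

lemma cheb_T_cos: "t \<in> {0..pi} \<Longrightarrow> cheb_T j (cos t) = cos (real j * t)"
  by (simp add: cheb_T_def arccos_cos)

text \<open>Each product of sine and cosine is a difference of sines at consecutive even multiples
  of \<open>x\<close>, so the sum telescopes.\<close>

lemma sin_times_sum_cos_odd:
  "2 * sin x * (\<Sum>l=1..N. cos ((2 * real l - 1) * x)) = sin (2 * real N * x)"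
proof (induction N)
  case (Suc N)
  have "2 * sin x * cos ((2 * real (Suc N) - 1) * x) = sin (2 * real (Suc N) * x) - sin (2 * real N * x)"
    using sin_times_cos[of x "(2 * real (Suc N) - 1) * x"] sin_minus[of "2 * real N * x"]
    by (simp add: algebra_simps)
  then show ?case using Suc by (simp add: distrib_left)
qed simp

text \<open>With \<open>x = q * pi / (2 * n)\<close> the telescoped sum is
  \<open>sin (q * pi) = 0\<close>, whereas \<open>sin x\<close> vanishes only if
  \<open>2 * n\<close> divides \<open>q\<close>.\<close>

lemma node_avg_eq_0:
  assumes "n \<ge> 1" and "\<not> int (2 * n) dvd q"
  shows "node_avg n q = 0"
proof -
  define x where "x = of_int q * pi / (2 * real n)"
  have "sin x \<noteq> 0"
  proof
    assume "sin x = 0"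
    then obtain i :: int where "x = of_int i * pi" using sin_zero_iff_int2 by blast
    then have "real_of_int q = real_of_int (int (2 * n) * i)"
      using \<open>n \<ge> 1\<close> by (simp add: x_def field_simps)
    then have "q = int (2 * n) * i" using of_int_eq_iff by blast
    then show False using assms by simp
  qed
  have "2 * real n * x = of_int q * pi" using \<open>n \<ge> 1\<close> by (simp add: x_def)
  then have "sin (2 * real n * x) = 0" using sin_zero_iff_int2 by blast
  then have "(\<Sum>l=1..n. cos ((2 * real l - 1) * x)) = 0"
    using sin_times_sum_cos_odd[of x n] \<open>sin x \<noteq> 0\<close> by simp
  moreover have "of_int q * node_angle n l = (2 * real l - 1) * x" for l
    by (simp add: node_angle_def x_def)
  ultimately show ?thesis by (simp add: node_avg_def)
qed

lemma node_avg_0: "n \<ge> 1 \<Longrightarrow> node_avg n 0 = 1"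
  by (simp add: node_avg_def)

lemma abs_node_avg_le: "\<bar>node_avg n q\<bar> \<le> 1"
proof -
  have "\<bar>\<Sum>l=1..n. cos (of_int q * node_angle n l)\<bar> \<le> (\<Sum>l=1..n. \<bar>cos (of_int q * node_angle n l)\<bar>)"
    by (rule sum_abs)
  also have "\<dots> \<le> (\<Sum>l=1..n. 1)" by (intro sum_mono) simp
  finally show ?thesis by (cases "n = 0") (simp_all add: node_avg_def)
qed

text \<open>
  \<open>aliased d n p\<close> is the truncated series with approximated coefficients of \<open>T\<^sub>p\<close>, at \<open>cos t\<close>.
\<close>

definition aliased :: "nat \<Rightarrow> nat \<Rightarrow> nat \<Rightarrow> real \<Rightarrow> real" where
  "aliased d n p t = (\<Sum>j=-int d..int d. node_avg n (int p + j) * cos (of_int j * t))"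

lemma sum_symmetric_int:
  "(\<Sum>j=-int d..int d. F j) = F 0 + (\<Sum>j=1..d. F (int j) + F (- int j))" for F :: "int \<Rightarrow> real"
proof (induction d)
  case (Suc d)
  have "{- int (Suc d)..int (Suc d)} = insert (int (Suc d)) (insert (- int (Suc d)) {- int d..int d})"
    by auto
  then show ?case using Suc by simp
qed simp

text \<open>Counted from its minimum \<open>m\<close>, every element of \<open>X\<close> is
  \<open>m + N * i\<close> with \<open>0 <= i < c\<close>.\<close>

lemma card_le_of_dvd_diff:
  fixes X :: "int set" and N :: int
  assumes "finite X" "N > 0" and dvd: "\<And>x y. x \<in> X \<Longrightarrow> y \<in> X \<Longrightarrow> N dvd x - y"
    and less: "\<And>x y. x \<in> X \<Longrightarrow> y \<in> X \<Longrightarrow> x - y < int c * N"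
  shows "card X \<le> c"
proof (cases "X = {}")
  case False
  define m where "m = Min X"
  have m: "m \<in> X" "\<And>x. x \<in> X \<Longrightarrow> m \<le> x" using \<open>finite X\<close> False by (auto simp: m_def)
  have "X \<subseteq> (\<lambda>i. m + N * int i) ` {..<c}"
  proof
    fix x assume x: "x \<in> X"
    then obtain i where i: "x - m = N * i" using dvd m by blast
    have "0 \<le> N * i" using m(2)[OF x] i by linarith
    then have "0 \<le> i" using \<open>N > 0\<close> by (simp add: zero_le_mult_iff)
    have "N * i < N * int c" using less[OF x m(1)] i by (simp add: mult.commute)
    then have "i < int c" using \<open>N > 0\<close> by simp
    then show "x \<in> (\<lambda>i. m + N * int i) ` {..<c}"
      using i \<open>0 \<le> i\<close> by (intro image_eqI[of _ _ "nat i"]) auto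
  qed
  then have "card X \<le> card {..<c}" by (rule surj_card_le[rotated]) simp
  then show ?thesis by simp
qed simp

lemma aliased_eq:
  assumes "n \<ge> 1"
  shows "aliased d n p t =
    (\<Sum>j | j \<in> {-int d..int d} \<and> int (2 * n) dvd int p + j. node_avg n (int p + j) * cos (of_int j * t))"
  unfolding aliased_def
  by (rule sum.mono_neutral_right) (auto simp: node_avg_eq_0[OF assms])

text \<open>For \<open>j\<close> between \<open>- d\<close> and \<open>d\<close>,
  \<open>p + j\<close> is smaller than \<open>2 * n\<close> in absolute value, so only
  \<open>j = - p\<close> survives; it lies in the range because \<open>p <= d\<close>.\<close>

lemma aliased_exact:
  assumes "n \<ge> 1" "p \<le> d" "p + d < 2 * n"
  shows "aliased d n p t = cos (real p * t)"
proof -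
  have "j = - int p" if j: "j \<in> {-int d..int d}" "int (2 * n) dvd int p + j" for j
  proof -
    have "\<bar>int p + j\<bar> < int (2 * n)" using j assms by auto
    then show ?thesis using dvd_imp_le_int[OF _ j(2)] by linarith
  qed
  then have "{j. j \<in> {-int d..int d} \<and> int (2 * n) dvd int p + j} = {- int p}"
    using \<open>p \<le> d\<close> by auto
  then show ?thesis using assms by (simp add: aliased_eq node_avg_0)
qed

text \<open>The surviving \<open>j\<close> are congruent modulo \<open>2 * n\<close> and differ by
  at most \<open>2 * d < c * (2 * n)\<close>, so there are at most \<open>c\<close> of them, each
  contributing at most 1.\<close>

lemma abs_aliased_le:
  assumes "n \<ge> 1" "d < c * n"
  shows "\<bar>aliased d n p t\<bar> \<le> real c"
proof -
  define X where "X = {j. j \<in> {-int d..int d} \<and> int (2 * n) dvd int p + j}"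
  have "\<bar>aliased d n p t\<bar> \<le> (\<Sum>j\<in>X. \<bar>node_avg n (int p + j) * cos (of_int j * t)\<bar>)"
    unfolding aliased_eq[OF \<open>n \<ge> 1\<close>] X_def[symmetric] by (rule sum_abs)
  also have "\<dots> \<le> (\<Sum>j\<in>X. 1)"
    using abs_node_avg_le by (intro sum_mono) (auto simp: abs_mult intro!: mult_le_one)
  also have "\<dots> = card X" by simp
  also have "card X \<le> c"
  proof (rule card_le_of_dvd_diff)
    show "int (2 * n) dvd x - y" if "x \<in> X" "y \<in> X" for x y
      using that dvd_diff[of "int (2 * n)" "int p + x" "int p + y"] by (simp add: X_def)
    show "x - y < int c * int (2 * n)" if "x \<in> X" "y \<in> X" for x y
    proof -
      have "x - y \<le> 2 * int d" using that by (auto simp: X_def)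
      also have "\<dots> < 2 * int (c * n)" using assms by linarith
      finally show ?thesis by simp
    qed
    show "finite X" by (rule finite_subset[of _ "{-int d..int d}"]) (auto simp: X_def)
  qed (use assms in simp)
  finally show ?thesis by simp
qed

section \<open>Pointwise error in terms of the coefficient tail\<close>

lemma cheb_series_cos:
  assumes "a < b" and t: "t \<in> {0..pi}"
  shows "cheb_series a b d n f (cheb_map a b (cos t)) =
    cheb_coeff a b f 0 n / 2 + (\<Sum>j=1..d. cheb_coeff a b f j n * cos (real j * t))"
proof -
  have "inv_into {-1..1} (cheb_map a b) (cheb_map a b (cos t)) = cos t"
    using cheb_map_bij_betw[OF \<open>a < b\<close>] by (intro inv_into_f_f) (auto simp: bij_betw_def)
  then show ?thesis by (simp add: cheb_series_def cheb_T_cos[OF t])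
qed

text \<open>The finite sum over the nodes is exchanged with the series; the product formula then
  gives averages at \<open>p + j\<close> and \<open>p - j\<close>.\<close>

lemma cheb_coeff_sums:
  assumes "n \<ge> 1"
    and series: "\<And>t. t \<in> {0..pi} \<Longrightarrow> (\<lambda>p. e p * cos (real p * t)) sums f (cheb_map a b (cos t))"
  shows "(\<lambda>p. e p * (node_avg n (int p + int j) + node_avg n (int p - int j))) sums cheb_coeff a b f j n"
proof -
  have node: "cheb_node n l = cos (node_angle n l)" for l
    by (simp add: cheb_node_def node_angle_def)
  have "cheb_coeff a b f j n =
      2 / real n * (\<Sum>l=1..n. f (cheb_map a b (cos (node_angle n l))) * cos (real j * node_angle n l))"
    unfolding cheb_coeff_def node
    by (intro arg_cong2[where f = "(*)"] sum.cong refl) (simp add: cheb_T_cos[OF node_angle_mem])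
  moreover have "(\<lambda>p. 2 / real n * (\<Sum>l=1..n. e p * cos (real p * node_angle n l) * cos (real j * node_angle n l)))
      sums (2 / real n * (\<Sum>l=1..n. f (cheb_map a b (cos (node_angle n l))) * cos (real j * node_angle n l)))"
    by (intro sums_mult sums_sum sums_mult2 series node_angle_mem)
  moreover have "2 / real n * (\<Sum>l=1..n. e p * cos (real p * node_angle n l) * cos (real j * node_angle n l))
      = e p * (node_avg n (int p + int j) + node_avg n (int p - int j))" for p
  proof -
    have "cos (of_int (int p + int j) * u) + cos (of_int (int p - int j) * u) =
        2 * (cos (real p * u) * cos (real j * u))" for u
      by (simp add: cos_times_cos distrib_right left_diff_distrib)
    then have "node_avg n (int p + int j) + node_avg n (int p - int j) =
        (\<Sum>l=1..n. 2 * (cos (real p * node_angle n l) * cos (real j * node_angle n l))) / real n"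
      unfolding node_avg_def by (simp only: add_divide_distrib[symmetric] sum.distrib[symmetric])
    then show ?thesis by (simp add: sum_distrib_left sum_divide_distrib mult_ac)
  qed
  ultimately show ?thesis by simp
qed

text \<open>The three conditions on \<open>M\<close> say that every order \<open>p < M\<close> is
  reproduced exactly. Any other order enters with weight at most \<open>1 + c\<close>: 1 for the
  cosine itself and \<open>c\<close> for its aliased image.\<close>

lemma cheb_series_error_bound:
  assumes "a < b" and "n \<ge> 1" and d: "d < c * n" and M: "1 \<le> M" "M \<le> d + 1" "M + d \<le> 2 * n"
    and series: "\<And>t. t \<in> {0..pi} \<Longrightarrow> (\<lambda>p. e p * cos (real p * t)) sums f (cheb_map a b (cos t))"
    and tail: "\<And>N. (\<Sum>p<N. \<bar>e (M + p)\<bar>) \<le> B"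
    and t: "t \<in> {0..pi}"
  shows "\<bar>f (cheb_map a b (cos t)) - cheb_series a b d n f (cheb_map a b (cos t))\<bar> \<le> (1 + real c) * B"
proof -
  let ?x = "cheb_map a b (cos t)"
  define E where "E = (\<lambda>p. e p * (cos (real p * t) - aliased d n p t))"
  \<comment> \<open>Pairing \<open>j\<close> with \<open>- j\<close> in the two-sided sum recovers
    the shape of the truncated series with its halved constant term.\<close>
  have expand: "aliased d n p t = node_avg n (int p) +
      (\<Sum>j=1..d. (node_avg n (int p + int j) + node_avg n (int p - int j)) * cos (real j * t))" for p
    unfolding aliased_def sum_symmetric_int by (simp add: distrib_right)
  have "(\<lambda>p. e p * (node_avg n (int p + int 0) + node_avg n (int p - int 0)) / 2 +
        (\<Sum>j=1..d. e p * (node_avg n (int p + int j) + node_avg n (int p - int j)) * cos (real j * t)))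
      sums cheb_series a b d n f ?x"
    unfolding cheb_series_cos[OF \<open>a < b\<close> t]
    by (intro sums_add sums_divide sums_sum sums_mult2 cheb_coeff_sums series \<open>n \<ge> 1\<close>)
  then have "(\<lambda>p. e p * aliased d n p t) sums cheb_series a b d n f ?x"
    by (simp add: expand distrib_left[of _ "node_avg n (int _)"] sum_distrib_left mult.assoc)
  from sums_diff[OF series[OF t] this] have "E sums (f ?x - cheb_series a b d n f ?x)"
    by (simp add: E_def right_diff_distrib)
  moreover have "E p = 0" if "p < M" for p
    using aliased_exact[of n p d t] that M \<open>n \<ge> 1\<close> by (simp add: E_def)
  ultimately have "(\<lambda>p. E (p + M)) sums (f ?x - cheb_series a b d n f ?x)"
    using sums_split_initial_segment[of E _ M] by fastforce
  then have "(\<lambda>N. \<bar>\<Sum>p<N. E (p + M)\<bar>) \<longlonglongrightarrow> \<bar>f ?x - cheb_series a b d n f ?x\<bar>"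
    unfolding sums_def by (rule tendsto_rabs)
  moreover have "\<bar>\<Sum>p<N. E (p + M)\<bar> \<le> (1 + real c) * B" for N
  proof -
    have "\<bar>\<Sum>p<N. E (p + M)\<bar> \<le> (\<Sum>p<N. \<bar>E (p + M)\<bar>)" by (rule sum_abs)
    also have "\<dots> \<le> (\<Sum>p<N. (1 + real c) * \<bar>e (M + p)\<bar>)"
    proof (rule sum_mono)
      fix p
      have "\<bar>cos (real (p + M) * t) - aliased d n (p + M) t\<bar> \<le> 1 + real c"
        using abs_aliased_le[OF \<open>n \<ge> 1\<close> d, of "p + M" t] abs_cos_le_one[of "real (p + M) * t"]
        by linarith
      then have "\<bar>e (p + M)\<bar> * \<bar>cos (real (p + M) * t) - aliased d n (p + M) t\<bar> \<le> \<bar>e (p + M)\<bar> * (1 + real c)"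
        by (intro mult_left_mono) auto
      then show "\<bar>E (p + M)\<bar> \<le> (1 + real c) * \<bar>e (M + p)\<bar>"
        by (simp add: E_def abs_mult mult.commute add.commute)
    qed
    also have "\<dots> \<le> (1 + real c) * B"
      unfolding sum_distrib_left[symmetric] by (intro mult_left_mono tail) auto
    finally show ?thesis .
  qed
  ultimately show ?thesis by (intro LIMSEQ_le_const2) auto
qed

section \<open>Decay from repeated integration by parts, and the integrated error\<close>

section \<open>Decay of the coefficients and the error bound\<close>

locale bv_function =
  fixes a b :: real and k :: nat and f :: "real \<Rightarrow> real" and D :: "nat \<Rightarrow> real \<Rightarrow> real"
  assumes less: "a < b" and k: "k \<ge> 1" and bvd: "bv_derivatives a b k f D"
begin

definition Var where "Var = total_variation a b (D k)"

text \<open>The \<open>i\<close>-th derivative of \<open>f\<close> read in the angle variable, not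
  the \<open>i\<close>-th derivative of \<open>h 0\<close>.\<close>

definition h where "h i t = D i (cheb_map a b (cos t))"

lemma continuous_D: "i < k \<Longrightarrow> continuous_on {a..b} (D i)"
  using bvd absolutely_continuous_imp_continuous_on by (simp add: bv_derivatives_def)

lemma continuous_h:
  assumes "i < k"
  shows "continuous_on {0..pi} (h i)"
proof -
  have "continuous_on {0..pi} (\<lambda>t. cheb_map a b (cos t))"
    unfolding cheb_map_def by (intro continuous_intros)
  then show ?thesis
    unfolding h_def
    by (rule continuous_on_compose2[OF continuous_D[OF assms]])
      (use cheb_map_cos_mem[OF less] in blast)
qed

lemma bounded_variation_D: "bounded_variation a b (D k)"
  using bvd by (simp add: bv_derivatives_def)

lemma Var_nonneg: "Var \<ge> 0"
proof -
  obtain s where s: "s \<in> variation_sums a b (D k)" using variation_sums_nonempty less by fastforce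
  then have "s \<le> Var"
    using bounded_variation_D
    unfolding Var_def total_variation_def bounded_variation_def by (intro cSup_upper)
  moreover have "s \<ge> 0" using s by (auto simp: variation_sums_def intro!: sum_nonneg)
  ultimately show ?thesis by simp
qed

lemma integrable_h: "i \<le> k \<Longrightarrow> (\<lambda>t. h i t * cos (real m * t)) integrable_on {0..pi}"
proof (cases "i = k")
  case True
  then show ?thesis
    using bounded_variation_cos_coeff(1)[OF less bounded_variation_D] by (simp add: h_def)
next
  case False
  assume "i \<le> k"
  then show ?thesis
    using False by (intro integrable_continuous_real continuous_intros continuous_h) auto
qed

text \<open>Treats all orders alike: the exceptional set is empty as long as the derivative is
  classical, and comes from the jumps of \<open>D k\<close> at the last order.\<close>

lemma D_derivative_off_countable:
  assumes "i < k"
  obtains S where "countable S"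
    "\<And>x. x \<in> {a<..<b} - S \<Longrightarrow> (D i has_real_derivative D (Suc i) x) (at x) \<and> isCont (D (Suc i)) x"
proof (cases "Suc i < k")
  case True
  have "(D i has_real_derivative D (Suc i) x) (at x) \<and> isCont (D (Suc i)) x"
    if x: "x \<in> {a<..<b}" for x
  proof
    have "(D i has_real_derivative D (Suc i) x) (at x within {a..b})"
      using bvd True x by (simp add: bv_derivatives_def)
    then show "(D i has_real_derivative D (Suc i) x) (at x)"
      using x by (simp add: at_within_Icc_at)
    have "continuous_on {a<..<b} (D (Suc i))"
      by (rule continuous_on_subset[OF continuous_D[OF True]]) auto
    then show "isCont (D (Suc i)) x" using x by (simp add: continuous_on_eq_continuous_at)
  qed
  then show ?thesis using that[of "{}"] by simp
next
  case False
  then have i: "k - 1 = i" "Suc i = k" using \<open>i < k\<close> by auto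
  have "\<And>x y. x \<in> {a..b} \<Longrightarrow> y \<in> {a..b} \<Longrightarrow> D i y - D i x = (LBINT t=x..y. D (Suc i) t)"
    using bvd unfolding bv_derivatives_def i by simp
  moreover have "bounded_variation a b (D (Suc i))" using bounded_variation_D i by simp
  ultimately show ?thesis
    using bounded_variation_indefinite_integral_deriv[OF less] that by metis
qed

lemma cos_coeff_h_recurrence:
  assumes "i < k" "j \<ge> 1"
  shows "cos_coeff (h i) j =
    (b - a) / 2 / (2 * real j) * (cos_coeff (h (Suc i)) (j - 1) - cos_coeff (h (Suc i)) (j + 1))"
proof -
  obtain S where S: "countable S" "\<And>x. x \<in> {a<..<b} - S \<Longrightarrow>
      (D i has_real_derivative D (Suc i) x) (at x) \<and> isCont (D (Suc i)) x"
    using D_derivative_off_countable[OF \<open>i < k\<close>] by blast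
  obtain S' where S': "countable S'" "\<And>t. t \<in> {0<..<pi} - S' \<Longrightarrow>
      (h i has_real_derivative - ((b - a) / 2 * sin t * h (Suc i) t)) (at t) \<and> isCont (h (Suc i)) t"
    using cheb_map_cos_has_derivative[OF less S] unfolding h_def by blast
  show ?thesis
    by (rule cos_coeff_by_parts[OF continuous_h[OF \<open>i < k\<close>] S' integrable_h \<open>j \<ge> 1\<close>])
      (use \<open>i < k\<close> in auto)
qed

text \<open>Induction on the number \<open>m\<close> of integrations by parts, starting at the last
  derivative. Each step contributes \<open>(b - a) / 4\<close>, and \<open>decay_Suc\<close> absorbs
  the factor \<open>1 / j\<close>. The condition \<open>j > m\<close> passes to both neighbouring
  orders in the step.\<close>

lemma cos_coeff_h_bound:
  assumes "m \<le> k" "j > m"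
  shows "\<bar>cos_coeff (h (k - m)) j\<bar> \<le> 2 * Var / pi * ((b - a) / 4) ^ m * decay m (real j)"
  using assms
proof (induction m arbitrary: j)
  case 0
  then show ?case
    using bounded_variation_cos_coeff(2)[OF less bounded_variation_D, of j]
    by (simp add: h_def decay_0 Var_def)
next
  case (Suc m)
  define C where "C = 2 * Var / pi * ((b - a) / 4) ^ m"
  have j: "real (j - 1) = real j - 1" "real (j + 1) = real j + 1" using Suc.prems by (auto simp: of_nat_diff)
  have "\<bar>cos_coeff (h (k - m)) (j - 1) - cos_coeff (h (k - m)) (j + 1)\<bar> \<le>
      C * decay m (real j - 1) + C * decay m (real j + 1)"
    using Suc.IH[of "j - 1"] Suc.IH[of "j + 1"] Suc.prems unfolding j C_def[symmetric] by linarith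
  also have "\<dots> = C * (real j * decay (Suc m) (real j))"
    using Suc.prems by (simp add: decay_Suc distrib_left)
  finally have "(b - a) / 2 / (2 * real j) * \<bar>cos_coeff (h (k - m)) (j - 1) - cos_coeff (h (k - m)) (j + 1)\<bar>
      \<le> (b - a) / 2 / (2 * real j) * (C * (real j * decay (Suc m) (real j)))"
    using less by (intro mult_left_mono) auto
  also have "\<dots> = C * ((b - a) / 4) * decay (Suc m) (real j)"
    using Suc.prems by (simp add: field_simps)
  also have "C * ((b - a) / 4) = 2 * Var / pi * ((b - a) / 4) ^ Suc m"
    by (simp add: C_def)
  finally show ?case
    using cos_coeff_h_recurrence[of "k - Suc m" j] Suc.prems less
    by (simp add: abs_mult Suc_diff_Suc)
qed

lemma sum_cos_coeff_le:
  assumes "M > k"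
  shows "(\<Sum>p<N. \<bar>cos_coeff (h 0) (M + p)\<bar>) \<le> 2 * Var / pi * ((b - a) / 4) ^ k *
    ((\<Sum>i\<le>k. real (k choose i) / falling (real M - 1 + real i) k) / real k)"
proof -
  have "(\<Sum>p<N. \<bar>cos_coeff (h 0) (M + p)\<bar>) \<le>
      (\<Sum>p<N. 2 * Var / pi * ((b - a) / 4) ^ k * decay k (real (M + p)))"
    using cos_coeff_h_bound[of k] assms by (intro sum_mono) (simp del: of_nat_add)
  also have "\<dots> = 2 * Var / pi * ((b - a) / 4) ^ k * (\<Sum>p<N. decay k (real (M + p)))"
    by (simp add: sum_distrib_left)
  also have "\<dots> \<le> 2 * Var / pi * ((b - a) / 4) ^ k *
    ((\<Sum>i\<le>k. real (k choose i) / falling (real M - 1 + real i) k) / real k)"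
    using less Var_nonneg by (intro mult_left_mono sum_decay_le k assms) auto
  finally show ?thesis .
qed

lemma summable_cos_coeff: "summable (\<lambda>j. \<bar>cos_coeff (h 0) j\<bar>)"
proof -
  have "summable (\<lambda>p. \<bar>cos_coeff (h 0) (Suc k + p)\<bar>)"
    by (rule bounded_imp_summable[OF _ sum_cos_coeff_le[of "Suc k" "Suc _", unfolded lessThan_Suc_atMost]]) auto
  then show ?thesis
    using summable_iff_shift[of "\<lambda>j. \<bar>cos_coeff (h 0) j\<bar>" "Suc k"] by (simp add: add.commute)
qed

lemma h_sums:
  assumes "t \<in> {0..pi}"
  shows "(\<lambda>p. (if p = 0 then cos_coeff (h 0) 0 / 2 else cos_coeff (h 0) p) * cos (real p * t))
    sums f (cheb_map a b (cos t))"
proof -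
  have "h 0 t = f (cheb_map a b (cos t))"
    using bvd cheb_map_cos_mem[OF less] by (simp add: h_def bv_derivatives_def)
  then show ?thesis
    using cos_series_sums[OF continuous_h summable_cos_coeff assms] k by simp
qed

lemma continuous_cheb_series: "continuous_on {a..b} (cheb_series a b d n f)"
proof -
  have "continuous_on {a..b} (\<lambda>x. cheb_coeff a b f 0 n / 2 +
     (\<Sum>j=1..d. cheb_coeff a b f j n * cos (real j * arccos (2 * (x - a) / (b - a) - 1))))"
    using less by (intro continuous_intros) (auto simp: field_simps)
  then show ?thesis
    by (rule continuous_on_eq) (auto simp: cheb_series_def inv_into_cheb_map[OF less] cheb_T_def)
qed

text \<open>A uniform error bound multiplied by the length \<open>b - a\<close>, which raises the
  exponent to \<open>k + 1\<close>. The factor \<open>2 * (1 + c)\<close> becomes 4 for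
  \<open>c = 1\<close> and 6 for \<open>c = 2\<close>.\<close>

lemma l1_error_bound:
  assumes "n \<ge> 1" and "d < c * n" and M: "k < M" "M \<le> d + 1" "M + d \<le> 2 * n"
  shows "l1_norm a b (\<lambda>x. f x - cheb_series a b d n f x) \<le>
    2 * (1 + real c) * Var * (b - a) ^ (k + 1) / (4 ^ k * real k * pi) *
      (\<Sum>j=0..k. real (k choose j) * (1 / falling (real M - 1 + real j) k))"
proof -
  define B where "B = 2 * Var / pi * ((b - a) / 4) ^ k *
    ((\<Sum>i\<le>k. real (k choose i) / falling (real M - 1 + real i) k) / real k)"
  let ?err = "\<lambda>x. \<bar>f x - cheb_series a b d n f x\<bar>"
  have bound: "?err x \<le> (1 + real c) * B" if "x \<in> {a..b}" for x
  proof -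
    have "x \<in> cheb_map a b ` {-1..1}"
      using cheb_map_bij_betw[OF less] that by (simp add: bij_betw_def)
    then obtain s where s: "s \<in> {-1..1}" "x = cheb_map a b s" by blast
    then have t: "arccos s \<in> {0..pi}" "x = cheb_map a b (cos (arccos s))"
      by (auto simp: arccos_lbound arccos_ubound)
    show ?thesis
      unfolding t(2)
      by (rule cheb_series_error_bound[OF less assms(1,2) _ M(2,3) h_sums _ t(1)])
        (use M(1) sum_cos_coeff_le[OF M(1)] in \<open>auto simp: B_def\<close>)
  qed
  have "continuous_on {a..b} (D 0)" using k by (intro continuous_D) auto
  then have "continuous_on {a..b} f"
    by (rule continuous_on_eq) (use bvd in \<open>simp add: bv_derivatives_def\<close>)
  then have cont: "continuous_on {a..b} ?err" by (intro continuous_intros continuous_cheb_series)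
  have "l1_norm a b (\<lambda>x. f x - cheb_series a b d n f x) = integral {a..b} ?err"
    unfolding l1_norm_def using less
    by (intro interval_integral_eq_integral borel_integrable_atLeastAtMost' cont) auto
  also have "\<dots> \<le> integral {a..b} (\<lambda>_. (1 + real c) * B)"
    by (intro integral_le integrable_continuous_real cont bound continuous_intros)
  also have "\<dots> = (b - a) * ((1 + real c) * B)" using less by simp
  also have "\<dots> = 2 * (1 + real c) * Var * (b - a) ^ (k + 1) / (4 ^ k * real k * pi) *
      (\<Sum>j=0..k. real (k choose j) * (1 / falling (real M - 1 + real j) k))"
  proof -
    have "x * ((1 + real c) * (2 * Var / pi * (x / 4) ^ k * (y / real k))) =
        2 * (1 + real c) * Var * x ^ (k + 1) / (4 ^ k * real k * pi) * y" for x y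
      by (simp add: power_divide mult_ac del: distrib_left_numeral distrib_right_numeral)
    then show ?thesis by (simp add: B_def atMost_atLeast0)
  qed
  finally show ?thesis .
qed

end

theorem theorem4p2:
  fixes a b V :: real and k d n :: nat
    and f :: "real \<Rightarrow> real" and D :: "nat \<Rightarrow> real \<Rightarrow> real"
  assumes "a < b" and "k \<ge> 1"
    and "bv_derivatives a b k f D"
    and "V = total_variation a b (D k)"
    and "n \<ge> k" and "k \<le> d" and "d \<le> 2 * n - k - 1"
  shows "(\<forall>l\<in>{1..n - k}. d = n - l \<longrightarrow>
            l1_norm a b (\<lambda>x. f x - cheb_series a b d n f x)
              \<le> 4 * V * (b - a) ^ (k + 1) / (4 ^ k * real k * pi) *
                (\<Sum>j=0..k. real (k choose j) *
                   (1 / (\<Prod>i=0..k - 1. real n - real l + real j - real i)))) \<and>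
         (\<forall>l\<in>{0..n - k - 1}. d = n + l \<longrightarrow>
            l1_norm a b (\<lambda>x. f x - cheb_series a b d n f x)
              \<le> 6 * V * (b - a) ^ (k + 1) / (4 ^ k * real k * pi) *
                (\<Sum>j=0..k. real (k choose j) *
                   (1 / (\<Prod>i=1..k. real n - real l + real j - real i))))"
proof -
  interpret bv_function a b k f D
    using assms(1-3) by (rule bv_function.intro)
  have V: "V = Var" using assms(4) Var_def by simp
  \<comment> \<open>Here \<open>d < n\<close>, so \<open>c = 1\<close>, and all orders up to
    \<open>d\<close> are reproduced: \<open>M = d + 1\<close>.\<close>
  have below: "l1_norm a b (\<lambda>x. f x - cheb_series a b d n f x)
      \<le> 4 * V * (b - a) ^ (k + 1) / (4 ^ k * real k * pi) *
        (\<Sum>j=0..k. real (k choose j) * (1 / (\<Prod>i=0..k - 1. real n - real l + real j - real i)))"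
    if l: "l \<in> {1..n - k}" "d = n - l" for l
  proof -
    have idx: "{0..k - 1} = {..<k}" using k by auto
    have "(\<Prod>i=0..k - 1. real n - real l + real j - real i) =
        falling (real (d + 1) - 1 + real j) k" for j
      unfolding falling_def idx using l by (intro prod.cong) (auto simp: of_nat_diff)
    moreover have "n \<ge> 1" "d < 1 * n" "k < d + 1" "d + 1 + d \<le> 2 * n" using l assms(2,5,6) by auto
    ultimately show ?thesis
      using l1_error_bound[of n d 1 "d + 1"] by (simp add: V)
  qed
  \<comment> \<open>Here only \<open>d < 2 * n\<close> holds, so \<open>c = 2\<close>; exactness
    requires \<open>p + d < 2 * n\<close>, whence \<open>M = 2 * n - d = n - l\<close>.\<close>
  have above: "l1_norm a b (\<lambda>x. f x - cheb_series a b d n f x)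
      \<le> 6 * V * (b - a) ^ (k + 1) / (4 ^ k * real k * pi) *
        (\<Sum>j=0..k. real (k choose j) * (1 / (\<Prod>i=1..k. real n - real l + real j - real i)))"
    if l: "l \<in> {0..n - k - 1}" "d = n + l" for l
  proof -
    \<comment> \<open>Excludes \<open>n = k\<close>, where truncated subtraction would make
      \<open>n - k - 1\<close> equal to 0 and still admit \<open>l = 0\<close>.\<close>
    have "k < n" using assms(2,6,7) by linarith
    then have ln: "l + k + 1 \<le> n" using l(1) by auto
    have "(\<Prod>i=1..k. real n - real l + real j - real i) =
        falling (real (n - l) - 1 + real j) k" for j
      unfolding falling_def using ln
      by (simp add: prod.atLeast1_atMost_eq of_nat_diff algebra_simps)
    moreover have "n \<ge> 1" "d < 2 * n" "k < n - l" "n - l \<le> d + 1" "n - l + d \<le> 2 * n"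
      using ln l assms(2) by auto
    ultimately show ?thesis
      using l1_error_bound[of n d 2 "n - l"] by (simp add: V)
  qed
  from below above show ?thesis by blast
qed

end
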